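(* Let $K$ be a field, let $n\ge1$, $\mu\ge1$ be integers and let $\mathcal{O}=\{1,x_n,x_n^2,\dots,x_n^{\mu-1}\}\subset\mathbb{T}^n$. Then the border basis scheme $\mathbb{B}_{\mathcal{O}}$ is isomorphic (over $K$) to the affine space $\mathbb{A}_K^{\mu n}$.
   Context: Notation: $\mathbb{T}^n=\{x_1^{\alpha_1}\cdots x_n^{\alpha_n}\mid\alpha_i\ge0\}$. For an order ideal (finite divisor-closed set of terms) $\mathcal{O}=\{t_1,\dots,t_\mu\}\subset\mathbb{T}^n$, the border is $\partial\mathcal{O}=(x_1\mathcal{O}\cup\dots\cup x_n\mathcal{O})\setminus\mathcal{O}=\{b_1,\dots,b_\nu\}$. Let $\mathbf{c}=\{c_{ij}\mid 1\le i\le\mu,1\le j\le\nu\}$ be indeterminates. For $k=1,\dots,n$ the generic multiplication matrix $\mathcal{A}_k\in\mathrm{Mat}_\mu(K[\mathbf{c}])$ has $(i,j)$ entry $\delta_{im}$ if $x_kt_j=t_m\in\mathcal{O}$, and $c_{im}$ if $x_kt_j=b_m\in\partial\mathcal{O}$. $I(\mathbb{B}_{\mathcal{O}})\subseteq K[\mathbf{c}]$ is the ideal generated by all entries of all $\mathcal{A}_k\mathcal{A}_\ell-\mathcal{A}_\ell\mathcal{A}_k$, $1\le k<\ell\le n$, and the $\mathcal{O}$-border basis scheme is $\mathbb{B}_{\mathcal{O}}=\mathrm{Spec}(K[\mathbf{c}]/I(\mathbb{B}_{\mathcal{O}}))\subseteq\mathbb{A}_K^{\mu\nu}$. *)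

theory Defs
  imports
    "HOL-Analysis.Abstract_Topology"
    "HOL-Algebra.QuotRing"
    "HOL-Library.Poly_Mapping"
    "Jordan_Normal_Form.Matrix"
begin

section \<open>Affine schemes over a field\<close>

text \<open>
  The structure sheaf of a scheme over \<open>K\<close> comes with a map from \<open>K\<close> to the global sections,
  which is the same thing as the structure morphism to \<open>Spec K\<close> (a single point).
  The field \<open>K\<close> is the type \<open>'k\<close>, \<open>'p\<close> is the type of points, \<open>'s\<close> the type of sections.
\<close>

record ('k, 'p, 's) scheme_over =
  space_top :: "'p topology"
  sections :: "'p set \<Rightarrow> 's ring"
  restriction :: "'p set \<Rightarrow> 'p set \<Rightarrow> 's \<Rightarrow> 's"
  scalar :: "'k \<Rightarrow> 's"

text \<open>
  An isomorphism of schemes is an isomorphism of ringed spaces: the inverse is then a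
  morphism as well, and ring isomorphisms between the local rings are automatically local.
  \<open>\<phi> U\<close> is the component at \<open>U\<close> of the sheaf map from the structure sheaf of \<open>Y\<close> to the direct
  image of the one of \<open>X\<close>; the last clause is compatibility with the structure morphisms to \<open>Spec K\<close>.
\<close>

definition isomorphic_over ::
  "('k, 'p, 's) scheme_over \<Rightarrow> ('k, 'q, 't) scheme_over \<Rightarrow> bool" (infix \<open>\<cong>\<^sub>K\<close> 50) where
  "X \<cong>\<^sub>K Y \<longleftrightarrow>
    (\<exists>f \<phi>. homeomorphic_map (space_top X) (space_top Y) f \<and>
      (let pre = (\<lambda>U. {x \<in> topspace (space_top X). f x \<in> U}) in
        (\<forall>U. openin (space_top Y) U \<longrightarrow> \<phi> U \<in> ring_iso (sections Y U) (sections X (pre U))) \<and>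
        (\<forall>U V. openin (space_top Y) U \<and> openin (space_top Y) V \<and> V \<subseteq> U \<longrightarrow>
          (\<forall>s \<in> carrier (sections Y U).
            restriction X (pre U) (pre V) (\<phi> U s) = \<phi> V (restriction Y U V s))) \<and>
        (\<forall>a. \<phi> (topspace (space_top Y)) (scalar Y a) = scalar X a)))"

definition prime_spectrum :: "'r ring \<Rightarrow> 'r set set" where
  "prime_spectrum R = {p. primeideal p R}"

definition zariski :: "'r ring \<Rightarrow> 'r set topology" where
  "zariski R = topology_generated_by {{p \<in> prime_spectrum R. f \<notin> p} | f. f \<in> carrier R}"

lemma topspace_zariski: "topspace (zariski R) = prime_spectrum R"
proof -
  have "\<exists>f \<in> carrier R. f \<notin> p" if "primeideal p R" for p
    using that primeideal.I_notcarr[OF that] ideal.Icarr[OF primeideal.axioms(1)[OF that]] by auto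
  thus ?thesis
    unfolding zariski_def topology_generated_by_topspace prime_spectrum_def by blast
qed

text \<open>
  Localization of \<open>R\<close> at a prime ideal \<open>p\<close>: \<open>loc_frac R p a s\<close> is the fraction \<open>a/s\<close>, the class of
  the pair \<open>(a, s)\<close>.  The unions in \<open>mult\<close> and \<open>add\<close> are unions of a constant family, i.e. they
  define the operations on representatives.
\<close>

definition loc_rel :: "'r ring \<Rightarrow> 'r set \<Rightarrow> (('r \<times> 'r) \<times> ('r \<times> 'r)) set" where
  "loc_rel R p = {((a, s), (b, t)).
     a \<in> carrier R \<and> b \<in> carrier R \<and> s \<in> carrier R - p \<and> t \<in> carrier R - p \<and>
     (\<exists>u \<in> carrier R - p. u \<otimes>\<^bsub>R\<^esub> (t \<otimes>\<^bsub>R\<^esub> a \<ominus>\<^bsub>R\<^esub> s \<otimes>\<^bsub>R\<^esub> b) = \<zero>\<^bsub>R\<^esub>)}"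

definition loc_frac :: "'r ring \<Rightarrow> 'r set \<Rightarrow> 'r \<Rightarrow> 'r \<Rightarrow> ('r \<times> 'r) set" where
  "loc_frac R p a s = loc_rel R p `` {(a, s)}"

lemma equiv_loc_rel:
  fixes R (structure) and p
  assumes "primeideal p (R :: 'r ring)"
  shows "equiv (carrier R \<times> (carrier R - p)) (loc_rel R p)"
proof -
  interpret p: primeideal p R by fact
  have one: "\<one> \<in> carrier R - p" using p.I_notcarr p.one_imp_carrier by auto
  have mult: "x \<otimes> y \<in> carrier R - p" if "x \<in> carrier R - p" "y \<in> carrier R - p" for x y
    using that p.I_prime by blast
  show ?thesis
  proof (rule equivI)
    show "loc_rel R p \<subseteq> (carrier R \<times> (carrier R - p)) \<times> (carrier R \<times> (carrier R - p))"
      by (auto simp: loc_rel_def)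
    show "refl_on (carrier R \<times> (carrier R - p)) (loc_rel R p)"
      unfolding refl_on_def loc_rel_def using one by (auto simp: p.r_neg p.minus_eq)
    show "sym (loc_rel R p)"
    proof (rule symI, clarsimp simp: loc_rel_def)
      fix a s b t u
      assume c: "a \<in> carrier R" "b \<in> carrier R" "s \<in> carrier R" "t \<in> carrier R" "u \<in> carrier R" "u \<notin> p"
        and e: "u \<otimes> (t \<otimes> a \<ominus> s \<otimes> b) = \<zero>"
      have "u \<otimes> (s \<otimes> b \<ominus> t \<otimes> a) = \<ominus> (u \<otimes> (t \<otimes> a \<ominus> s \<otimes> b))" using c by algebra
      with c e show "\<exists>u\<in>carrier R - p. u \<otimes> (s \<otimes> b \<ominus> t \<otimes> a) = \<zero>" by auto
    qed
    show "trans (loc_rel R p)"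
    proof (rule transI, clarsimp simp: loc_rel_def)
      fix a s b t c r u v
      assume c: "a \<in> carrier R" "b \<in> carrier R" "c \<in> carrier R" "s \<in> carrier R" "t \<in> carrier R"
          "r \<in> carrier R" "u \<in> carrier R" "v \<in> carrier R"
        and n: "s \<notin> p" "t \<notin> p" "r \<notin> p" "u \<notin> p" "v \<notin> p"
        and e: "u \<otimes> (t \<otimes> a \<ominus> s \<otimes> b) = \<zero>" "v \<otimes> (r \<otimes> b \<ominus> t \<otimes> c) = \<zero>"
      have "(u \<otimes> v \<otimes> t) \<otimes> (r \<otimes> a \<ominus> s \<otimes> c)
          = v \<otimes> r \<otimes> (u \<otimes> (t \<otimes> a \<ominus> s \<otimes> b)) \<oplus> u \<otimes> s \<otimes> (v \<otimes> (r \<otimes> b \<ominus> t \<otimes> c))"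
        using c by algebra
      also have "\<dots> = \<zero>" using c by (simp add: e)
      finally have "(u \<otimes> v \<otimes> t) \<otimes> (r \<otimes> a \<ominus> s \<otimes> c) = \<zero>" .
      moreover have "u \<otimes> v \<otimes> t \<in> carrier R - p"
        by (intro mult DiffI) (use c n in auto)
      ultimately show "\<exists>u\<in>carrier R - p. u \<otimes> (r \<otimes> a \<ominus> s \<otimes> c) = \<zero>" by blast
    qed
  qed
qed

definition localization :: "'r ring \<Rightarrow> 'r set \<Rightarrow> ('r \<times> 'r) set ring" where
  "localization R p = \<lparr>
     carrier = (carrier R \<times> (carrier R - p)) // loc_rel R p,
     monoid.mult = (\<lambda>X Y. \<Union>(a, s) \<in> X. \<Union>(b, t) \<in> Y. loc_frac R p (a \<otimes>\<^bsub>R\<^esub> b) (s \<otimes>\<^bsub>R\<^esub> t)),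
     one = loc_frac R p \<one>\<^bsub>R\<^esub> \<one>\<^bsub>R\<^esub>,
     ring.zero = loc_frac R p \<zero>\<^bsub>R\<^esub> \<one>\<^bsub>R\<^esub>,
     ring.add = (\<lambda>X Y. \<Union>(a, s) \<in> X. \<Union>(b, t) \<in> Y.
              loc_frac R p (a \<otimes>\<^bsub>R\<^esub> t \<oplus>\<^bsub>R\<^esub> b \<otimes>\<^bsub>R\<^esub> s) (s \<otimes>\<^bsub>R\<^esub> t))\<rparr>"

text \<open>
  Sections over an open \<open>U\<close>: families of elements of the local rings at the points of \<open>U\<close>
  (made \<open>undefined\<close> outside \<open>U\<close>) that are locally fractions.
\<close>

definition structure_sheaf :: "'r ring \<Rightarrow> 'r set set \<Rightarrow> ('r set \<Rightarrow> ('r \<times> 'r) set) ring" where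
  "structure_sheaf R U = \<lparr>
     carrier = {s \<in> (\<Pi>\<^sub>E p \<in> U. carrier (localization R p)).
        \<forall>p \<in> U. \<exists>V. openin (zariski R) V \<and> p \<in> V \<and> V \<subseteq> U \<and>
          (\<exists>a \<in> carrier R. \<exists>f \<in> carrier R. \<forall>q \<in> V. f \<notin> q \<and> s q = loc_frac R q a f)},
     monoid.mult = (\<lambda>s t. \<lambda>p\<in>U. s p \<otimes>\<^bsub>localization R p\<^esub> t p),
     one = (\<lambda>p\<in>U. \<one>\<^bsub>localization R p\<^esub>),
     ring.zero = (\<lambda>p\<in>U. \<zero>\<^bsub>localization R p\<^esub>),
     ring.add = (\<lambda>s t. \<lambda>p\<in>U. s p \<oplus>\<^bsub>localization R p\<^esub> t p)\<rparr>"

text \<open>\<open>Spec R\<close> as a scheme over \<open>K\<close>, for a \<open>K\<close>-algebra \<open>R\<close> with structure homomorphism \<open>\<kappa>\<close>.\<close>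

definition Spec ::
  "'r ring \<Rightarrow> ('k \<Rightarrow> 'r) \<Rightarrow> ('k, 'r set, 'r set \<Rightarrow> ('r \<times> 'r) set) scheme_over" where
  "Spec R \<kappa> = \<lparr>
     space_top = zariski R,
     sections = structure_sheaf R,
     restriction = (\<lambda>U V s. restrict s V),
     scalar = (\<lambda>a. \<lambda>p\<in>prime_spectrum R. loc_frac R p (\<kappa> a) \<one>\<^bsub>R\<^esub>)\<rparr>"


section \<open>Polynomial rings and affine space\<close>

text \<open>
  Polynomials with coefficients in \<open>'k\<close> in indeterminates of type \<open>'v\<close>: finitely supported
  coefficient functions on finitely supported exponent vectors.
\<close>

type_synonym ('v, 'k) mpoly = "('v \<Rightarrow>\<^sub>0 nat) \<Rightarrow>\<^sub>0 'k"

definition Const :: "'k \<Rightarrow> ('v, 'k::field) mpoly" where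
  "Const a = Poly_Mapping.single 0 a"

definition Var :: "'v \<Rightarrow> ('v, 'k::field) mpoly" where
  "Var v = Poly_Mapping.single (Poly_Mapping.single v 1) 1"

definition poly_ring :: "'v set \<Rightarrow> ('v, 'k::field) mpoly ring" where
  "poly_ring V = \<lparr>
     carrier = {P. \<forall>m \<in> Poly_Mapping.keys P. Poly_Mapping.keys m \<subseteq> V},
     monoid.mult = (*), one = 1, zero = 0, add = (+)\<rparr>"

lemma cring_poly_ring: "cring (poly_ring V :: ('v, 'k::field) mpoly ring)"
proof -
  let ?C = "carrier (poly_ring V :: ('v, 'k) mpoly ring)"
  have mem: "P \<in> ?C \<longleftrightarrow> (\<forall>m \<in> Poly_Mapping.keys P. Poly_Mapping.keys m \<subseteq> V)" for P :: "('v, 'k) mpoly"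
    by (simp add: poly_ring_def)
  have add: "P + Q \<in> ?C" if "P \<in> ?C" "Q \<in> ?C" for P Q
    using that Poly_Mapping.keys_add[of P Q] unfolding mem by blast
  have mult: "P * Q \<in> ?C" if "P \<in> ?C" "Q \<in> ?C" for P Q
    unfolding mem
  proof
    fix m assume "m \<in> Poly_Mapping.keys (P * Q)"
    then obtain a b where "m = a + b" "a \<in> Poly_Mapping.keys P" "b \<in> Poly_Mapping.keys Q"
      using Poly_Mapping.keys_mult[of P Q] by blast
    with that Poly_Mapping.keys_add[of a b] show "Poly_Mapping.keys m \<subseteq> V" unfolding mem by blast
  qed
  have zero: "0 \<in> ?C" and one: "1 \<in> ?C" by (simp_all add: mem)
  have uminus: "- P \<in> ?C" if "P \<in> ?C" for P using that by (simp add: mem)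
  have ops: "x \<oplus>\<^bsub>poly_ring V\<^esub> y = x + y" "x \<otimes>\<^bsub>poly_ring V\<^esub> y = x * y"
      "\<zero>\<^bsub>poly_ring V\<^esub> = 0" "\<one>\<^bsub>poly_ring V\<^esub> = 1" for x y :: "('v, 'k) mpoly"
    by (simp_all add: poly_ring_def)
  have "abelian_group (poly_ring V :: ('v, 'k) mpoly ring)"
  proof (rule abelian_groupI, unfold ops)
    show "\<exists>y \<in> ?C. y + x = 0" if "x \<in> ?C" for x
      by (rule bexI[OF _ uminus[OF that]]) (rule left_minus)
  qed (simp_all only: add zero add.assoc add_0_left, simp only: add.commute)
  moreover have "comm_monoid (poly_ring V :: ('v, 'k) mpoly ring)"
    by (rule comm_monoidI, unfold ops) (simp_all only: mult one mult.assoc mult_1_left, simp only: mult.commute)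
  ultimately show ?thesis
    by (rule cringI) (unfold ops, rule distrib_right)
qed

type_synonym ('k, 'r) affine_scheme = "('k, 'r set, 'r set \<Rightarrow> ('r \<times> 'r) set) scheme_over"

definition affine_space :: "nat \<Rightarrow> ('k::field, (nat, 'k) mpoly) affine_scheme" where
  "affine_space N = Spec (poly_ring {1..N}) Const"


section \<open>Border basis schemes\<close>

text \<open>
  The term \<open>x\<^sub>1\<^sup>\<alpha>\<^sup>1 \<dots> x\<^sub>n\<^sup>\<alpha>\<^sup>n\<close> is represented by its exponent vector, so that products of terms
  become sums; indeterminates \<open>x\<^sub>k\<close> are numbered from 1.
\<close>

type_synonym pterm = "nat \<Rightarrow>\<^sub>0 nat"

definition terms :: "nat \<Rightarrow> pterm set" where
  "terms n = {t. Poly_Mapping.keys t \<subseteq> {1..n}}"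

definition term_dvd :: "pterm \<Rightarrow> pterm \<Rightarrow> bool" where
  "term_dvd s t \<longleftrightarrow> (\<exists>u. t = s + u)"

definition order_ideal :: "nat \<Rightarrow> pterm set \<Rightarrow> bool" where
  "order_ideal n \<O> \<longleftrightarrow> finite \<O> \<and> \<O> \<subseteq> terms n \<and> (\<forall>t \<in> \<O>. \<forall>s. term_dvd s t \<longrightarrow> s \<in> \<O>)"

lemma order_ideal_powers:
  assumes "n \<ge> 1"
  shows "order_ideal n {Poly_Mapping.single n i | i. i < \<mu>}"
proof -
  have dvd: "\<exists>j. s = Poly_Mapping.single n j \<and> j < \<mu>"
    if e: "Poly_Mapping.single n i = s + u" and i: "i < \<mu>" for i and s u :: pterm
  proof (intro exI conjI)
    have l: "Poly_Mapping.lookup (Poly_Mapping.single n i) k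
        = Poly_Mapping.lookup s k + Poly_Mapping.lookup u k" for k
      by (simp add: e lookup_add)
    show "s = Poly_Mapping.single n (Poly_Mapping.lookup s n)"
    proof (rule poly_mapping_eqI)
      fix k show "Poly_Mapping.lookup s k
          = Poly_Mapping.lookup (Poly_Mapping.single n (Poly_Mapping.lookup s n)) k"
        using l[of k] by (auto simp: lookup_single when_def split: if_splits)
    qed
    show "Poly_Mapping.lookup s n < \<mu>" using l[of n] i by simp
  qed
  have sub: "{Poly_Mapping.single n i | i. i < \<mu>} \<subseteq> terms n"
    using assms by (auto simp: terms_def split: if_splits)
  show ?thesis
    unfolding order_ideal_def term_dvd_def
  proof (intro conjI ballI allI impI)
    fix t s assume "t \<in> {Poly_Mapping.single n i | i. i < \<mu>}" "\<exists>u. t = s + u"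
    then obtain i u where *: "t = Poly_Mapping.single n i" "i < \<mu>" "t = s + u" by blast
    from dvd[OF *(3)[unfolded *(1)] *(2)] show "s \<in> {Poly_Mapping.single n i | i. i < \<mu>}" by blast
  next
    show "finite {Poly_Mapping.single n i | i. i < \<mu>}" by (rule finite_image_set) simp
  qed (rule sub)
qed

definition times_var :: "nat \<Rightarrow> pterm \<Rightarrow> pterm" where
  "times_var k t = Poly_Mapping.single k 1 + t"

definition border :: "nat \<Rightarrow> pterm set \<Rightarrow> pterm set" where
  "border n \<O> = (\<Union>k \<in> {1..n}. times_var k ` \<O>) - \<O>"

text \<open>
  Below, \<open>ts\<close> and \<open>bs\<close> are enumerations (without repetition) of an order ideal and of its border.
  Positions in these lists, and hence the indices of \<open>c\<^sub>i\<^sub>j\<close> and of matrix entries, start at 0.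
\<close>

definition generic_mult_mat ::
  "pterm list \<Rightarrow> pterm list \<Rightarrow> nat \<Rightarrow> (nat \<times> nat, 'k::field) mpoly mat" where
  "generic_mult_mat ts bs k = mat (length ts) (length ts) (\<lambda>(i, j).
     let s = times_var k (ts ! j) in
       if s \<in> set ts then (if ts ! i = s then 1 else 0)
       else Var (i, THE m. m < length bs \<and> bs ! m = s))"

definition coord_ring :: "pterm list \<Rightarrow> pterm list \<Rightarrow> (nat \<times> nat, 'k::field) mpoly ring" where
  "coord_ring ts bs = poly_ring ({..<length ts} \<times> {..<length bs})"

definition border_basis_ideal ::
  "nat \<Rightarrow> pterm list \<Rightarrow> pterm list \<Rightarrow> (nat \<times> nat, 'k::field) mpoly set" where
  "border_basis_ideal n ts bs = genideal (coord_ring ts bs)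
     (\<Union>{elements_mat (generic_mult_mat ts bs k * generic_mult_mat ts bs l
                       - generic_mult_mat ts bs l * generic_mult_mat ts bs k)
         | k l. 1 \<le> k \<and> k < l \<and> l \<le> n})"

definition border_basis_scheme ::
  "nat \<Rightarrow> pterm list \<Rightarrow> pterm list \<Rightarrow> ('k::field, (nat \<times> nat, 'k) mpoly set) affine_scheme" where
  "border_basis_scheme n ts bs =
     Spec (coord_ring ts bs Quot border_basis_ideal n ts bs)
          (\<lambda>a. border_basis_ideal n ts bs +>\<^bsub>coord_ring ts bs\<^esub> Const a)"

end

theory Submission
  imports Defs
begin

text \<open>
  Write \<open>x = x\<^sub>n\<close> and \<open>d\<close> for the column of indeterminates belonging to the border term \<open>x\<^sup>\<mu>\<close>; the other
  border terms are \<open>x\<^sub>k x\<^sup>j\<close> with \<open>k < n\<close> and \<open>j < \<mu>\<close>.  The matrix \<open>A\<^sub>n\<close> is the companion matrix of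
  \<open>f = x\<^sup>\<mu> - \<Sum> d\<^sub>a x\<^sup>a\<close>, that is, multiplication by \<open>x\<close> modulo \<open>f\<close>.  Comparing columns in
  \<open>A\<^sub>k A\<^sub>n = A\<^sub>n A\<^sub>k\<close> shows that column \<open>j + 1\<close> of \<open>A\<^sub>k\<close> is \<open>A\<^sub>n\<close> times column \<open>j\<close>.  Hence the relations
  determine every column of \<open>A\<^sub>k\<close> from its column \<open>v\<^sub>k\<close> at the term \<open>1\<close>: column \<open>j\<close> must be the vector of
  coefficients of \<open>v\<^sub>k(x) x\<^sup>j\<close> modulo \<open>f\<close>.  Conversely, for arbitrary \<open>d\<close> and arbitrary \<open>v\<^sub>k\<close> the matrices
  with these columns are multiplications by polynomials modulo \<open>f\<close>, so all of them commute.  The free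
  parameters are therefore the \<open>\<mu>\<close> entries of \<open>d\<close> and of each \<open>v\<^sub>k\<close>, which are \<open>\<mu> n\<close> in total.

  Algebraically, the substitution \<open>\<phi>\<close> sends each \<open>c\<^sub>i\<^sub>j\<close> to the expression that the relations force upon it.
  It kills the generators of the ideal (\<open>subst_relation\<close>), and the substitution \<open>\<psi>\<close>, which reads
  the parameters as entries of \<open>d\<close> and of the \<open>v\<^sub>k\<close>, is a right inverse of it (\<open>subst_\<phi>_\<psi>\<close>) and a left
  inverse modulo the ideal (\<open>subst_\<psi>_\<phi>\<close>).  So \<open>\<phi>\<close> induces an isomorphism from the coordinate ring of the
  border basis scheme to a polynomial ring, and isomorphic \<open>K\<close>-algebras have isomorphic spectra
  (\<open>Spec_isomorphic\<close>).
\<close>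

section \<open>Isomorphic algebras have isomorphic spectra\<close>

definition contraction :: "'s ring \<Rightarrow> ('s \<Rightarrow> 'r) \<Rightarrow> 'r set \<Rightarrow> 's set" where
  "contraction S g p = {y \<in> carrier S. g y \<in> p}"

text \<open>
  The hypotheses are symmetric in the two rings, so that every fact about the passage from \<open>S\<close> to \<open>R\<close>
  can be used for the way back as well; this is how bijectivity is obtained below.
\<close>

locale inverse_ring_isos = S: cring S + R: cring R
  for S :: "'s ring" and R :: "'r ring" +
  fixes g :: "'s \<Rightarrow> 'r" and h :: "'r \<Rightarrow> 's"
  assumes g_hom: "g \<in> Ring.ring_hom S R" and h_hom: "h \<in> Ring.ring_hom R S"
    and hg: "y \<in> carrier S \<Longrightarrow> h (g y) = y" and gh: "x \<in> carrier R \<Longrightarrow> g (h x) = x"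
begin

lemma swapped: "inverse_ring_isos R S h g"
  by (intro inverse_ring_isos.intro inverse_ring_isos_axioms.intro S.is_cring R.is_cring g_hom h_hom hg gh)

abbreviation f :: "'r set \<Rightarrow> 's set" where "f \<equiv> contraction S g"

lemma g_closed: "y \<in> carrier S \<Longrightarrow> g y \<in> carrier R"
  by (rule ring_hom_closed[OF g_hom])

lemma prime_contraction: "p \<in> prime_spectrum R \<Longrightarrow> f p \<in> prime_spectrum S"
proof -
  interpret g: ring_hom_ring S R g
    by (rule ring_hom_ringI2[OF S.ring_axioms R.ring_axioms g_hom])
  show "p \<in> prime_spectrum R \<Longrightarrow> f p \<in> prime_spectrum S"
    unfolding prime_spectrum_def contraction_def
    using g.primeideal_vimage[OF S.is_cring] by simp
qed

lemma contraction_contraction: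
  assumes "p \<subseteq> carrier R"
  shows "contraction R h (f p) = p"
  using assms gh ring_hom_closed[OF h_hom] by (auto simp: contraction_def)

lemma prime_subset: "p \<in> prime_spectrum R \<Longrightarrow> p \<subseteq> carrier R"
  unfolding prime_spectrum_def
  using additive_subgroup.a_subset ideal.axioms(1) primeideal.axioms(1) by blast

lemma loc_rel_contraction:
  assumes "((a, s), (b, t)) \<in> loc_rel S (f p)"
  shows "((g a, g s), (g b, g t)) \<in> loc_rel R p"
proof -
  interpret g: ring_hom_ring S R g
    by (rule ring_hom_ringI2[OF S.ring_axioms R.ring_axioms g_hom])
  from assms obtain u where c: "a \<in> carrier S" "b \<in> carrier S" "s \<in> carrier S" "t \<in> carrier S"
      "u \<in> carrier S" and n: "g s \<notin> p" "g t \<notin> p" "g u \<notin> p"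
      and e: "u \<otimes>\<^bsub>S\<^esub> (t \<otimes>\<^bsub>S\<^esub> a \<ominus>\<^bsub>S\<^esub> s \<otimes>\<^bsub>S\<^esub> b) = \<zero>\<^bsub>S\<^esub>"
    by (auto simp: loc_rel_def contraction_def)
  have "g (u \<otimes>\<^bsub>S\<^esub> (t \<otimes>\<^bsub>S\<^esub> a \<ominus>\<^bsub>S\<^esub> s \<otimes>\<^bsub>S\<^esub> b)) = \<zero>\<^bsub>R\<^esub>"
    by (simp add: e)
  hence "g u \<otimes>\<^bsub>R\<^esub> (g t \<otimes>\<^bsub>R\<^esub> g a \<ominus>\<^bsub>R\<^esub> g s \<otimes>\<^bsub>R\<^esub> g b) = \<zero>\<^bsub>R\<^esub>"
    using c by (simp add: S.minus_eq R.minus_eq)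
  with c n g_closed show ?thesis
    unfolding loc_rel_def by blast
qed

text \<open>
  One inclusion is \<open>loc_rel_contraction\<close> for \<open>g\<close>, the other one is the same lemma for the inverse \<open>h\<close>,
  because \<open>p\<close> is in turn the contraction along \<open>h\<close> of \<open>f p\<close>.
\<close>

lemma image_loc_frac:
  assumes p: "p \<subseteq> carrier R" and a: "a \<in> carrier S" and s: "s \<in> carrier S - f p"
  shows "map_prod g g ` loc_frac S (f p) a s = loc_frac R p (g a) (g s)"
proof
  show "map_prod g g ` loc_frac S (f p) a s \<subseteq> loc_frac R p (g a) (g s)"
    using loc_rel_contraction by (auto simp: loc_frac_def)
next
  interpret sw: inverse_ring_isos R S h g by (rule swapped)
  show "loc_frac R p (g a) (g s) \<subseteq> map_prod g g ` loc_frac S (f p) a s"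
  proof
    fix x assume x: "x \<in> loc_frac R p (g a) (g s)"
    obtain b t where [simp]: "x = (b, t)" by fastforce
    have r: "((g a, g s), (b, t)) \<in> loc_rel R (contraction R h (f p))"
      using x by (simp add: loc_frac_def contraction_contraction[OF p])
    hence bt: "b \<in> carrier R" "t \<in> carrier R" by (auto simp: loc_rel_def)
    have "((a, s), (h b, h t)) \<in> loc_rel S (f p)"
      using sw.loc_rel_contraction[OF r] hg a s by simp
    hence "map_prod g g (h b, h t) \<in> map_prod g g ` loc_frac S (f p) a s"
      by (intro imageI) (simp add: loc_frac_def)
    thus "x \<in> map_prod g g ` loc_frac S (f p) a s" using bt gh by simp
  qed
qed

lemma localization_memE:
  assumes "X \<in> carrier (localization S q)"
  obtains a s where "a \<in> carrier S" "s \<in> carrier S - q" "X = loc_frac S q a s"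
  using assms by (auto simp: localization_def loc_frac_def quotient_def)

lemma localization_subset:
  assumes "X \<in> carrier (localization S q)"
  shows "X \<subseteq> carrier S \<times> (carrier S - q)"
  using assms by (auto simp: localization_def quotient_def loc_rel_def)

lemma image_localization:
  assumes p: "p \<subseteq> carrier R" and X: "X \<in> carrier (localization S (f p))"
  shows "map_prod g g ` X \<in> carrier (localization R p)"
proof -
  from X obtain a s where as: "a \<in> carrier S" "s \<in> carrier S - f p" "X = loc_frac S (f p) a s"
    by (rule localization_memE)
  hence "g s \<in> carrier R - p" "g a \<in> carrier R" using g_closed by (auto simp: contraction_def)
  thus ?thesis
    unfolding as(3) image_loc_frac[OF p as(1,2)]
    by (auto simp: localization_def loc_frac_def quotient_def)
qed

lemma mult_notin:
  assumes "p \<in> prime_spectrum S" "s \<in> carrier S - p" "t \<in> carrier S - p"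
  shows "s \<otimes>\<^bsub>S\<^esub> t \<in> carrier S - p"
  using assms primeideal.I_prime[of p S s t] by (auto simp: prime_spectrum_def)

text \<open>
  Since the operations of a localization are unions over all representatives, the image under \<open>g\<close>
  can be taken inside these unions, where it matches the representatives of \<open>X\<close> with those of its
  image; on single fractions, \<open>image_loc_frac\<close> applies.
\<close>

lemma image_localization_mult:
  assumes p: "p \<in> prime_spectrum R"
    and X: "X \<in> carrier (localization S (f p))" and Y: "Y \<in> carrier (localization S (f p))"
  shows "map_prod g g ` (X \<otimes>\<^bsub>localization S (f p)\<^esub> Y)
       = map_prod g g ` X \<otimes>\<^bsub>localization R p\<^esub> map_prod g g ` Y"
proof -
  interpret g: ring_hom_ring S R g
    by (rule ring_hom_ringI2[OF S.ring_axioms R.ring_axioms g_hom])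
  have *: "map_prod g g ` loc_frac S (f p) (a \<otimes>\<^bsub>S\<^esub> b) (s \<otimes>\<^bsub>S\<^esub> t)
      = loc_frac R p (g a \<otimes>\<^bsub>R\<^esub> g b) (g s \<otimes>\<^bsub>R\<^esub> g t)"
    if "(a, s) \<in> X" "(b, t) \<in> Y" for a s b t
  proof -
    have "a \<in> carrier S" "b \<in> carrier S" "s \<in> carrier S - f p" "t \<in> carrier S - f p"
      using that localization_subset[OF X] localization_subset[OF Y] by blast+
    thus ?thesis
      using mult_notin[OF prime_contraction[OF p], of s t]
      by (subst image_loc_frac[OF prime_subset[OF p]]) auto
  qed
  have "map_prod g g ` (X \<otimes>\<^bsub>localization S (f p)\<^esub> Y)
     = (\<Union>x\<in>X. \<Union>y\<in>Y. map_prod g g ` loc_frac S (f p) (fst x \<otimes>\<^bsub>S\<^esub> fst y) (snd x \<otimes>\<^bsub>S\<^esub> snd y))"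
    by (simp add: localization_def image_UN case_prod_unfold)
  also have "\<dots> = (\<Union>x\<in>X. \<Union>y\<in>Y. loc_frac R p (g (fst x) \<otimes>\<^bsub>R\<^esub> g (fst y)) (g (snd x) \<otimes>\<^bsub>R\<^esub> g (snd y)))"
    by (intro SUP_cong refl *) auto
  also have "\<dots> = map_prod g g ` X \<otimes>\<^bsub>localization R p\<^esub> map_prod g g ` Y"
    by (simp add: localization_def case_prod_unfold)
  finally show ?thesis .
qed

lemma image_localization_add:
  assumes p: "p \<in> prime_spectrum R"
    and X: "X \<in> carrier (localization S (f p))" and Y: "Y \<in> carrier (localization S (f p))"
  shows "map_prod g g ` (X \<oplus>\<^bsub>localization S (f p)\<^esub> Y)
       = map_prod g g ` X \<oplus>\<^bsub>localization R p\<^esub> map_prod g g ` Y"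
proof -
  interpret g: ring_hom_ring S R g
    by (rule ring_hom_ringI2[OF S.ring_axioms R.ring_axioms g_hom])
  have *: "map_prod g g ` loc_frac S (f p) (a \<otimes>\<^bsub>S\<^esub> t \<oplus>\<^bsub>S\<^esub> b \<otimes>\<^bsub>S\<^esub> s) (s \<otimes>\<^bsub>S\<^esub> t)
      = loc_frac R p (g a \<otimes>\<^bsub>R\<^esub> g t \<oplus>\<^bsub>R\<^esub> g b \<otimes>\<^bsub>R\<^esub> g s) (g s \<otimes>\<^bsub>R\<^esub> g t)"
    if "(a, s) \<in> X" "(b, t) \<in> Y" for a s b t
  proof -
    have "a \<in> carrier S" "b \<in> carrier S" "s \<in> carrier S - f p" "t \<in> carrier S - f p"
      using that localization_subset[OF X] localization_subset[OF Y] by blast+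
    thus ?thesis
      using mult_notin[OF prime_contraction[OF p], of s t]
      by (subst image_loc_frac[OF prime_subset[OF p]]) auto
  qed
  have "map_prod g g ` (X \<oplus>\<^bsub>localization S (f p)\<^esub> Y)
     = (\<Union>x\<in>X. \<Union>y\<in>Y. map_prod g g `
          loc_frac S (f p) (fst x \<otimes>\<^bsub>S\<^esub> snd y \<oplus>\<^bsub>S\<^esub> fst y \<otimes>\<^bsub>S\<^esub> snd x) (snd x \<otimes>\<^bsub>S\<^esub> snd y))"
    by (simp add: localization_def image_UN case_prod_unfold)
  also have "\<dots> = (\<Union>x\<in>X. \<Union>y\<in>Y. loc_frac R p
      (g (fst x) \<otimes>\<^bsub>R\<^esub> g (snd y) \<oplus>\<^bsub>R\<^esub> g (fst y) \<otimes>\<^bsub>R\<^esub> g (snd x)) (g (snd x) \<otimes>\<^bsub>R\<^esub> g (snd y)))"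
    by (intro SUP_cong refl *) auto
  also have "\<dots> = map_prod g g ` X \<oplus>\<^bsub>localization R p\<^esub> map_prod g g ` Y"
    by (simp add: localization_def case_prod_unfold)
  finally show ?thesis .
qed

lemma one_notin: "q \<in> prime_spectrum S \<Longrightarrow> \<one>\<^bsub>S\<^esub> \<in> carrier S - q"
  using primeideal.I_notcarr[of q S] ideal.one_imp_carrier[of q S] primeideal.axioms(1)[of q S]
  by (auto simp: prime_spectrum_def)

lemma image_localization_one:
  assumes p: "p \<in> prime_spectrum R"
  shows "map_prod g g ` \<one>\<^bsub>localization S (f p)\<^esub> = \<one>\<^bsub>localization R p\<^esub>"
  using image_loc_frac[OF prime_subset[OF p] S.one_closed one_notin[OF prime_contraction[OF p]]]
  by (simp add: localization_def ring_hom_one[OF g_hom])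

definition pre :: "'s set set \<Rightarrow> 'r set set" where
  "pre U = {p \<in> prime_spectrum R. f p \<in> U}"

lemma continuous_contraction: "continuous_map (zariski R) (zariski S) f"
  unfolding zariski_def[of S]
proof (rule continuous_on_generated_topo)
  fix U assume "U \<in> {{q \<in> prime_spectrum S. a \<notin> q} | a. a \<in> carrier S}"
  then obtain a where a: "a \<in> carrier S" "U = {q \<in> prime_spectrum S. a \<notin> q}" by blast
  have "f -` U \<inter> topspace (zariski R) = {p \<in> prime_spectrum R. g a \<notin> p}"
    using a prime_contraction by (auto simp: topspace_zariski contraction_def)
  thus "openin (zariski R) (f -` U \<inter> topspace (zariski R))"
    unfolding zariski_def using g_closed[OF a(1)]
    by (simp add: topology_generated_by_Basis) (rule topology_generated_by_Basis, blast)
next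
  have "prime_spectrum S = \<Union> {{q \<in> prime_spectrum S. a \<notin> q} | a. a \<in> carrier S}"
    using topspace_zariski[of S] unfolding zariski_def topology_generated_by_topspace by (rule sym)
  thus "f ` topspace (zariski R) \<subseteq> \<Union> {{q \<in> prime_spectrum S. a \<notin> q} | a. a \<in> carrier S}"
    using prime_contraction by (auto simp only: topspace_zariski)
qed

lemma open_pre: "openin (zariski S) U \<Longrightarrow> openin (zariski R) (pre U)"
  using openin_continuous_map_preimage[OF continuous_contraction, of U]
  by (simp add: pre_def topspace_zariski)

lemma homeomorphic_contraction: "homeomorphic_map (zariski R) (zariski S) f"
proof -
  interpret sw: inverse_ring_isos R S h g by (rule swapped)
  show ?thesis
    unfolding homeomorphic_map_maps homeomorphic_maps_def
    using continuous_contraction sw.continuous_contraction contraction_contraction[OF prime_subset]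
      sw.contraction_contraction[OF sw.prime_subset]
    by (intro exI[of _ "contraction R h"]) (auto simp: topspace_zariski)
qed

definition sheaf_map :: "'s set set \<Rightarrow> ('s set \<Rightarrow> ('s \<times> 's) set) \<Rightarrow> 'r set \<Rightarrow> ('r \<times> 'r) set" where
  "sheaf_map U s = (\<lambda>p\<in>pre U. map_prod g g ` s (f p))"

lemma sections_stalk:
  assumes "s \<in> carrier (structure_sheaf S U)" and "q \<in> U"
  shows "s q \<in> carrier (localization S q)"
  using assms by (auto simp: structure_sheaf_def)

text \<open>
  A local representation \<open>a/b\<close> of \<open>s\<close> on \<open>V\<close> becomes the representation \<open>g a/g b\<close> of the image on the
  preimage of \<open>V\<close>.
\<close>

lemma sheaf_map_closed:
  assumes s: "s \<in> carrier (structure_sheaf S U)"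
  shows "sheaf_map U s \<in> carrier (structure_sheaf R (pre U))"
  unfolding structure_sheaf_def partial_object.select_convs mem_Collect_eq
proof (intro conjI ballI)
  show "sheaf_map U s \<in> (\<Pi>\<^sub>E p \<in> pre U. carrier (localization R p))"
    unfolding sheaf_map_def
    by (intro restrict_PiE_iff[THEN iffD2] ballI image_localization prime_subset sections_stalk[OF s])
      (simp_all add: pre_def)
next
  fix p assume p: "p \<in> pre U"
  hence "f p \<in> U" by (simp add: pre_def)
  have "\<forall>p \<in> U. \<exists>V. openin (zariski S) V \<and> p \<in> V \<and> V \<subseteq> U \<and>
      (\<exists>a \<in> carrier S. \<exists>b \<in> carrier S. \<forall>q \<in> V. b \<notin> q \<and> s q = loc_frac S q a b)"
    using s by (simp add: structure_sheaf_def)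
  from bspec[OF this \<open>f p \<in> U\<close>] obtain V a b
    where V: "openin (zariski S) V" "f p \<in> V" "V \<subseteq> U" and ab: "a \<in> carrier S" "b \<in> carrier S"
      and fr: "\<forall>q \<in> V. b \<notin> q \<and> s q = loc_frac S q a b"
    by (elim exE conjE bexE)
  have "g b \<notin> q \<and> sheaf_map U s q = loc_frac R q (g a) (g b)" if q: "q \<in> pre V" for q
  proof -
    from q have q': "q \<in> prime_spectrum R" "f q \<in> V" "q \<in> pre U" using V(3) by (auto simp: pre_def)
    hence sq: "b \<notin> f q" "s (f q) = loc_frac S (f q) a b" using fr by blast+
    hence "sheaf_map U s q = map_prod g g ` loc_frac S (f q) a b"
      using q' by (simp add: sheaf_map_def)
    moreover have "map_prod g g ` loc_frac S (f q) a b = loc_frac R q (g a) (g b)"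
      using sq(1) ab by (intro image_loc_frac prime_subset q') simp_all
    ultimately show ?thesis using sq(1) ab(2) by (simp add: contraction_def)
  qed
  moreover have "p \<in> pre V" "pre V \<subseteq> pre U" using p V by (auto simp: pre_def)
  ultimately show "\<exists>V. openin (zariski R) V \<and> p \<in> V \<and> V \<subseteq> pre U \<and>
      (\<exists>a \<in> carrier R. \<exists>b \<in> carrier R. \<forall>q \<in> V. b \<notin> q \<and> sheaf_map U s q = loc_frac R q a b)"
    using open_pre[OF V(1)] g_closed[OF ab(1)] g_closed[OF ab(2)]
    by (intro exI[of _ "pre V"] conjI bexI[of _ "g a"] bexI[of _ "g b"]) simp_all
qed

lemma pre_pre:
  assumes U: "U \<subseteq> prime_spectrum S"
  shows "inverse_ring_isos.pre R S h (pre U) = U"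
proof -
  interpret sw: inverse_ring_isos R S h g by (rule swapped)
  show ?thesis
    using U sw.contraction_contraction[OF sw.prime_subset] sw.prime_contraction
    by (auto simp: sw.pre_def pre_def)
qed

lemma sheaf_map_inverse:
  assumes "s \<in> carrier (structure_sheaf S U)" and U: "U \<subseteq> prime_spectrum S"
  shows "inverse_ring_isos.sheaf_map R S h (pre U) (sheaf_map U s) = s"
proof -
  interpret sw: inverse_ring_isos R S h g by (rule swapped)
  have c: "f (sw.f q) = q" if "q \<in> prime_spectrum S" for q
    using sw.contraction_contraction[OF sw.prime_subset[OF that]] .
  note pp = pre_pre[OF U]
  show "sw.sheaf_map (pre U) (sheaf_map U s) = s"
  proof (rule extensionalityI[of _ U])
    show "sw.sheaf_map (pre U) (sheaf_map U s) \<in> extensional U"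
      by (simp add: sw.sheaf_map_def pp)
    show "s \<in> extensional U" using assms by (simp add: structure_sheaf_def PiE_iff)
    fix q assume q: "q \<in> U"
    hence q': "q \<in> prime_spectrum S" using U by blast
    have "map_prod h h ` map_prod g g ` X = X" if "X \<subseteq> carrier S \<times> carrier S" for X
    proof -
      have "map_prod h h (map_prod g g x) = x" if "x \<in> X" for x
        using that \<open>X \<subseteq> _\<close> hg by auto
      hence "(map_prod h h \<circ> map_prod g g) ` X = id ` X" by (intro image_cong) simp_all
      thus ?thesis by (simp add: image_comp)
    qed
    moreover have "s q \<subseteq> carrier S \<times> carrier S"
      using localization_subset[OF sections_stalk[OF assms(1) q]] by blast
    moreover have "sw.f q \<in> pre U" using q q' c sw.prime_contraction by (simp add: pre_def)
    ultimately show "sw.sheaf_map (pre U) (sheaf_map U s) q = s q"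
      using q q' c by (simp add: sw.sheaf_map_def pp sheaf_map_def)
  qed
qed

lemma sheaf_map_iso:
  assumes U: "openin (zariski S) U"
  shows "sheaf_map U \<in> ring_iso (structure_sheaf S U) (structure_sheaf R (pre U))"
proof -
  interpret sw: inverse_ring_isos R S h g by (rule swapped)
  have US: "U \<subseteq> prime_spectrum S" using openin_subset[OF U] by (simp add: topspace_zariski)
  have RU: "pre U \<subseteq> prime_spectrum R" by (auto simp: pre_def)
  have "sheaf_map U \<in> Ring.ring_hom (structure_sheaf S U) (structure_sheaf R (pre U))"
  proof (rule ring_hom_memI)
    fix s t assume st: "s \<in> carrier (structure_sheaf S U)" "t \<in> carrier (structure_sheaf S U)"
    show "sheaf_map U (s \<otimes>\<^bsub>structure_sheaf S U\<^esub> t)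
        = sheaf_map U s \<otimes>\<^bsub>structure_sheaf R (pre U)\<^esub> sheaf_map U t"
      using sections_stalk[OF st(1)] sections_stalk[OF st(2)]
      by (auto simp: structure_sheaf_def sheaf_map_def pre_def fun_eq_iff restrict_def image_localization_mult)
    show "sheaf_map U (s \<oplus>\<^bsub>structure_sheaf S U\<^esub> t)
        = sheaf_map U s \<oplus>\<^bsub>structure_sheaf R (pre U)\<^esub> sheaf_map U t"
      using sections_stalk[OF st(1)] sections_stalk[OF st(2)]
      by (auto simp: structure_sheaf_def sheaf_map_def pre_def fun_eq_iff restrict_def image_localization_add)
  next
    show "sheaf_map U \<one>\<^bsub>structure_sheaf S U\<^esub> = \<one>\<^bsub>structure_sheaf R (pre U)\<^esub>"
      by (auto simp: structure_sheaf_def sheaf_map_def pre_def fun_eq_iff image_localization_one)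
  qed (rule sheaf_map_closed)
  moreover have "bij_betw (sheaf_map U) (carrier (structure_sheaf S U)) (carrier (structure_sheaf R (pre U)))"
  proof (rule bij_betwI[where g = "sw.sheaf_map (pre U)"])
    show "sheaf_map U \<in> carrier (structure_sheaf S U) \<rightarrow> carrier (structure_sheaf R (pre U))"
      using sheaf_map_closed by blast
    show "sw.sheaf_map (pre U) \<in> carrier (structure_sheaf R (pre U)) \<rightarrow> carrier (structure_sheaf S U)"
      using sw.sheaf_map_closed[of _ "pre U"] unfolding pre_pre[OF US] by blast
    show "sw.sheaf_map (pre U) (sheaf_map U s) = s" if "s \<in> carrier (structure_sheaf S U)" for s
      by (rule sheaf_map_inverse[OF that US])
    show "sheaf_map U (sw.sheaf_map (pre U) t) = t" if "t \<in> carrier (structure_sheaf R (pre U))" for t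
      using sw.sheaf_map_inverse[OF that RU] by (simp add: pre_pre[OF US])
  qed
  ultimately show ?thesis by (simp add: ring_iso_def)
qed

lemma Spec_isomorphic:
  assumes g_scalar: "\<And>a. g (\<kappa> a) = \<rho> a" and \<kappa>: "\<And>a. \<kappa> a \<in> carrier S"
  shows "Spec R \<rho> \<cong>\<^sub>K Spec S \<kappa>"
proof -
  have pre: "pre U = {p \<in> prime_spectrum R. f p \<in> U}" for U by (simp add: pre_def)
  have pre_all: "pre (prime_spectrum S) = prime_spectrum R"
    using prime_contraction by (auto simp: pre_def)
  have sc: "sheaf_map (prime_spectrum S) (\<lambda>p\<in>prime_spectrum S. loc_frac S p (\<kappa> a) \<one>\<^bsub>S\<^esub>)
      = (\<lambda>p\<in>prime_spectrum R. loc_frac R p (\<rho> a) \<one>\<^bsub>R\<^esub>)" for a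
    using image_loc_frac[OF prime_subset \<kappa> one_notin[OF prime_contraction]] prime_contraction
    by (auto simp: sheaf_map_def pre_all fun_eq_iff g_scalar ring_hom_one[OF g_hom])
  have res: "restrict (sheaf_map U s) (pre V) = sheaf_map V (restrict s V)"
    if "V \<subseteq> U" for U V s
    using that by (auto simp: sheaf_map_def pre_def fun_eq_iff)
  have main: "homeomorphic_map (zariski R) (zariski S) f \<and>
    (\<forall>U. openin (zariski S) U \<longrightarrow>
        sheaf_map U \<in> ring_iso (structure_sheaf S U) (structure_sheaf R (pre U))) \<and>
    (\<forall>U V. openin (zariski S) U \<and> openin (zariski S) V \<and> V \<subseteq> U \<longrightarrow>
        (\<forall>s \<in> carrier (structure_sheaf S U).
            restrict (sheaf_map U s) (pre V) = sheaf_map V (restrict s V))) \<and>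
    (\<forall>a. sheaf_map (prime_spectrum S) (\<lambda>p\<in>prime_spectrum S. loc_frac S p (\<kappa> a) \<one>\<^bsub>S\<^esub>)
      = (\<lambda>p\<in>prime_spectrum R. loc_frac R p (\<rho> a) \<one>\<^bsub>R\<^esub>))"
    by (intro conjI allI impI ballI homeomorphic_contraction sheaf_map_iso res sc) auto
  show ?thesis
    unfolding isomorphic_over_def Let_def Spec_def scheme_over.select_convs topspace_zariski
    by (rule exI[of _ f], rule exI[of _ sheaf_map], rule main[unfolded pre])
qed

end

section \<open>Substitution in polynomials\<close>

lemma poly_ring_sel:
  "P \<otimes>\<^bsub>poly_ring V\<^esub> Q = P * Q" "P \<oplus>\<^bsub>poly_ring V\<^esub> Q = P + Q"
  "\<zero>\<^bsub>poly_ring V\<^esub> = 0" "\<one>\<^bsub>poly_ring V\<^esub> = 1"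
  by (simp_all add: poly_ring_def)

lemma a_minus_poly_ring:
  assumes "Q \<in> carrier (poly_ring V)"
  shows "P \<ominus>\<^bsub>poly_ring V\<^esub> Q = P - Q"
proof -
  interpret cring "poly_ring V" by (rule cring_poly_ring)
  have "Q + \<ominus>\<^bsub>poly_ring V\<^esub> Q = 0"
    using r_neg[OF assms] by (simp add: poly_ring_sel)
  hence "\<ominus>\<^bsub>poly_ring V\<^esub> Q = - Q" by (simp add: eq_neg_iff_add_eq_0 add.commute)
  thus ?thesis by (simp add: minus_eq poly_ring_sel)
qed

lemma poly_ring_closed:
  shows "P \<in> carrier (poly_ring V) \<Longrightarrow> Q \<in> carrier (poly_ring V) \<Longrightarrow> P + Q \<in> carrier (poly_ring V)"
    and "P \<in> carrier (poly_ring V) \<Longrightarrow> Q \<in> carrier (poly_ring V) \<Longrightarrow> P * Q \<in> carrier (poly_ring V)"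
    and "P \<in> carrier (poly_ring V) \<Longrightarrow> Q \<in> carrier (poly_ring V) \<Longrightarrow> P - Q \<in> carrier (poly_ring V)"
    and "0 \<in> carrier (poly_ring V)" and "1 \<in> carrier (poly_ring V)"
proof -
  interpret cring "poly_ring V" by (rule cring_poly_ring)
  show "P \<in> carrier (poly_ring V) \<Longrightarrow> Q \<in> carrier (poly_ring V) \<Longrightarrow> P + Q \<in> carrier (poly_ring V)"
    using a_closed[of P Q] by (simp add: poly_ring_sel)
  show "P \<in> carrier (poly_ring V) \<Longrightarrow> Q \<in> carrier (poly_ring V) \<Longrightarrow> P * Q \<in> carrier (poly_ring V)"
    using m_closed[of P Q] by (simp add: poly_ring_sel)
  show "P \<in> carrier (poly_ring V) \<Longrightarrow> Q \<in> carrier (poly_ring V) \<Longrightarrow> P - Q \<in> carrier (poly_ring V)"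
    using minus_closed[of P Q] by (simp add: a_minus_poly_ring)
  show "0 \<in> carrier (poly_ring V)" "1 \<in> carrier (poly_ring V)"
    using zero_closed one_closed by (simp_all add: poly_ring_sel)
qed

lemma sum_in_poly_ring:
  "(\<And>x. x \<in> A \<Longrightarrow> F x \<in> carrier (poly_ring V)) \<Longrightarrow> sum F A \<in> carrier (poly_ring V)"
  by (induction A rule: infinite_finite_induct) (auto intro: poly_ring_closed)

lemma Const_in_poly_ring: "Const a \<in> carrier (poly_ring V)"
  by (simp add: Const_def poly_ring_def)

lemma Var_in_poly_ring: "v \<in> V \<Longrightarrow> Var v \<in> carrier (poly_ring V)"
  by (simp add: Var_def poly_ring_def)

lemma Const_0: "Const 0 = 0"
  and Const_1: "Const 1 = 1"
  and Const_add: "Const (a + b) = Const a + Const b"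
  and Const_mult: "Const (a * b) = Const a * Const b"
  by (simp_all add: Const_def single_add mult_single)

lemma poly_mapping_sum_single:
  "(\<Sum>k\<in>Poly_Mapping.keys m. Poly_Mapping.single k (Poly_Mapping.lookup m k)) = m"
  by (rule poly_mapping_eqI)
    (auto simp: lookup_sum lookup_single when_def sum.delta in_keys_iff)

text \<open>
  Multiplicativity of \<open>Q\<close> builds first the powers of a single indeterminate and then their products.
\<close>

lemma monomial_induct:
  fixes P :: "('v, 'k::field) mpoly"
  assumes one: "Q 1" and Var: "\<And>v. v \<in> V \<Longrightarrow> Q (Var v :: ('v, 'k) mpoly)"
    and mult: "\<And>A B. A \<in> carrier (poly_ring V) \<Longrightarrow> B \<in> carrier (poly_ring V) \<Longrightarrow> Q A \<Longrightarrow> Q B \<Longrightarrow> Q (A * B)"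
    and m: "Poly_Mapping.keys m \<subseteq> V"
  shows "Q (Poly_Mapping.single m 1)"
proof -
  have pow: "Q (Poly_Mapping.single (Poly_Mapping.single v k) 1)" if "v \<in> V" for v k
  proof (induction k)
    case 0
    thus ?case using one by simp
  next
    case (Suc k)
    have "Poly_Mapping.single (Poly_Mapping.single v (Suc k)) 1
        = Var v * (Poly_Mapping.single (Poly_Mapping.single v k) 1 :: ('v, 'k) mpoly)"
      by (simp add: Var_def mult_single flip: single_add)
    moreover have "(Poly_Mapping.single (Poly_Mapping.single v k) 1 :: ('v, 'k) mpoly) \<in> carrier (poly_ring V)"
      using that by (simp add: poly_ring_def)
    ultimately show ?case using mult[OF Var_in_poly_ring[OF that] _ Var[OF that] Suc.IH] by simp
  qed
  have "Q (Poly_Mapping.single (\<Sum>v\<in>A. Poly_Mapping.single v (Poly_Mapping.lookup m v)) 1)"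
    if "finite A" "A \<subseteq> V" for A
    using that
  proof (induction A)
    case empty
    thus ?case using one by simp
  next
    case (insert v A)
    let ?s = "\<Sum>v\<in>A. Poly_Mapping.single v (Poly_Mapping.lookup m v)"
    have "Poly_Mapping.single (\<Sum>v\<in>insert v A. Poly_Mapping.single v (Poly_Mapping.lookup m v)) 1
        = Poly_Mapping.single (Poly_Mapping.single v (Poly_Mapping.lookup m v)) 1
          * (Poly_Mapping.single ?s 1 :: ('v, 'k) mpoly)"
      using insert.hyps by (simp add: mult_single)
    moreover have "Poly_Mapping.keys ?s \<subseteq> V"
      using insert.prems by (intro order.trans[OF keys_sum]) (auto split: if_splits)
    hence "(Poly_Mapping.single ?s 1 :: ('v, 'k) mpoly) \<in> carrier (poly_ring V)"
      by (simp add: poly_ring_def)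
    moreover have "(Poly_Mapping.single (Poly_Mapping.single v (Poly_Mapping.lookup m v)) 1 :: ('v, 'k) mpoly)
        \<in> carrier (poly_ring V)"
      using insert.prems by (simp add: poly_ring_def)
    ultimately show ?case using mult[OF _ _ pow insert.IH] insert.prems by simp
  qed
  from this[OF finite_keys m] show ?thesis by (simp add: poly_mapping_sum_single)
qed

text \<open>
  The polynomials in the indeterminates \<open>V\<close> are generated as a ring by constants and indeterminates.
  Identities and congruences between substitutions are checked with this rule.
\<close>

lemma poly_ring_induct [consumes 1, case_names Const Var add mult]:
  fixes P :: "('v, 'k::field) mpoly"
  assumes P: "P \<in> carrier (poly_ring V)"
    and Const: "\<And>a. Q (Const a)" and Var: "\<And>v. v \<in> V \<Longrightarrow> Q (Var v)"
    and add: "\<And>A B. A \<in> carrier (poly_ring V) \<Longrightarrow> B \<in> carrier (poly_ring V) \<Longrightarrow> Q A \<Longrightarrow> Q B \<Longrightarrow> Q (A + B)"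
    and mult: "\<And>A B. A \<in> carrier (poly_ring V) \<Longrightarrow> B \<in> carrier (poly_ring V) \<Longrightarrow> Q A \<Longrightarrow> Q B \<Longrightarrow> Q (A * B)"
  shows "Q P"
proof -
  have mono: "Q (Poly_Mapping.single m c)" if "m \<in> Poly_Mapping.keys P" for m c
  proof -
    have m: "Poly_Mapping.keys m \<subseteq> V" using P that by (simp add: poly_ring_def)
    have "Q (1 :: ('v, 'k) mpoly)" using Const[of 1] by (simp add: Const_1)
    from monomial_induct[where Q = Q, OF this Var mult m] have "Q (Poly_Mapping.single m 1)" .
    moreover have "(Poly_Mapping.single m 1 :: ('v, 'k) mpoly) \<in> carrier (poly_ring V)"
      using m by (simp add: poly_ring_def)
    ultimately have "Q (Const c * Poly_Mapping.single m 1)"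
      by (intro mult Const Const_in_poly_ring)
    thus ?thesis by (simp add: Const_def mult_single)
  qed
  have "Q (\<Sum>m\<in>A. Poly_Mapping.single m (Poly_Mapping.lookup P m))"
    if "finite A" "A \<subseteq> Poly_Mapping.keys P" for A
    using that
  proof (induction A)
    case empty
    thus ?case using Const[of 0] by (simp add: Const_0)
  next
    case (insert m A)
    have "(\<Sum>m\<in>A. Poly_Mapping.single m (Poly_Mapping.lookup P m)) \<in> carrier (poly_ring V)"
      using insert.prems P by (intro sum_in_poly_ring) (auto simp: poly_ring_def split: if_splits)
    moreover have "Poly_Mapping.single m (Poly_Mapping.lookup P m) \<in> carrier (poly_ring V)"
      using insert.prems P by (auto simp: poly_ring_def split: if_splits)
    ultimately show ?case using add mono insert by simp
  qed
  from this[OF finite_keys subset_refl] show ?thesis by (simp add: poly_mapping_sum_single)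
qed

definition subst_monomial :: "('v \<Rightarrow> ('w, 'k::field) mpoly) \<Rightarrow> ('v \<Rightarrow>\<^sub>0 nat) \<Rightarrow> ('w, 'k) mpoly" where
  "subst_monomial \<sigma> m = (\<Prod>v\<in>Poly_Mapping.keys m. \<sigma> v ^ Poly_Mapping.lookup m v)"

definition subst :: "('v \<Rightarrow> ('w, 'k::field) mpoly) \<Rightarrow> ('v, 'k) mpoly \<Rightarrow> ('w, 'k) mpoly" where
  "subst \<sigma> P = (\<Sum>m\<in>Poly_Mapping.keys P. Const (Poly_Mapping.lookup P m) * subst_monomial \<sigma> m)"

lemma subst_monomial_superset:
  assumes "finite A" "Poly_Mapping.keys m \<subseteq> A"
  shows "subst_monomial \<sigma> m = (\<Prod>v\<in>A. \<sigma> v ^ Poly_Mapping.lookup m v)"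
  unfolding subst_monomial_def
  by (rule prod.mono_neutral_left) (use assms in \<open>auto simp: in_keys_iff\<close>)

lemma subst_monomial_add: "subst_monomial \<sigma> (m + m') = subst_monomial \<sigma> m * subst_monomial \<sigma> m'"
  using Poly_Mapping.keys_add[of m m']
  by (simp add: subst_monomial_superset[of "Poly_Mapping.keys m \<union> Poly_Mapping.keys m'"]
      lookup_add power_add prod.distrib)

lemma subst_add: "subst \<sigma> (P + Q) = subst \<sigma> P + subst \<sigma> Q"
  unfolding subst_def
  by (rule setsum_keys_plus_distrib[where f = "\<lambda>m c. Const c * subst_monomial \<sigma> m"])
     (simp_all add: Const_0 Const_add distrib_right)

lemma subst_0 [simp]: "subst \<sigma> 0 = 0"
  by (simp add: subst_def)

lemma subst_sum: "subst \<sigma> (sum F A) = (\<Sum>x\<in>A. subst \<sigma> (F x))"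
  by (induction A rule: infinite_finite_induct) (simp_all add: subst_add)

lemma subst_single: "subst \<sigma> (Poly_Mapping.single m c) = Const c * subst_monomial \<sigma> m"
  by (simp add: subst_def Const_0)

lemma subst_Const: "subst \<sigma> (Const c) = Const c"
  using subst_single[of \<sigma> 0 c] by (simp add: subst_monomial_def flip: Const_def)

lemma subst_1 [simp]: "subst \<sigma> 1 = 1"
  using subst_Const[of \<sigma> 1] by (simp add: Const_1)

lemma subst_Var: "subst \<sigma> (Var v) = \<sigma> v"
  unfolding Var_def[of v] subst_single by (simp add: subst_monomial_def Const_1)

text \<open>
  Both sides are biadditive in \<open>P\<close> and \<open>Q\<close>, so it suffices to compare them on terms.
\<close>

lemma subst_mult: "subst \<sigma> (P * Q) = subst \<sigma> P * subst \<sigma> Q"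
proof -
  have sing: "subst \<sigma> (Poly_Mapping.single m c * Poly_Mapping.single m' c')
      = subst \<sigma> (Poly_Mapping.single m c) * subst \<sigma> (Poly_Mapping.single m' c')" for m c m' c'
    by (simp add: mult_single subst_single subst_monomial_add Const_mult mult_ac)
  let ?f = "\<lambda>P m. Poly_Mapping.single m (Poly_Mapping.lookup P m)"
  have "subst \<sigma> (sum (?f P) (Poly_Mapping.keys P) * sum (?f Q) (Poly_Mapping.keys Q))
      = subst \<sigma> (sum (?f P) (Poly_Mapping.keys P)) * subst \<sigma> (sum (?f Q) (Poly_Mapping.keys Q))"
    by (simp only: sum_product subst_sum sing)
  thus ?thesis by (simp only: poly_mapping_sum_single)
qed

lemma subst_diff: "subst \<sigma> (P - Q) = subst \<sigma> P - subst \<sigma> Q"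
  using subst_add[of \<sigma> "P - Q" Q] by simp

lemma subst_closed:
  assumes "P \<in> carrier (poly_ring V)" and "\<And>v. v \<in> V \<Longrightarrow> \<sigma> v \<in> carrier (poly_ring W)"
  shows "subst \<sigma> P \<in> carrier (poly_ring W)"
  using assms(1)
  by (induction P rule: poly_ring_induct)
    (simp_all add: subst_Const subst_Var subst_add subst_mult poly_ring_closed Const_in_poly_ring assms(2))

lemma subst_ring_hom:
  assumes "\<And>v. v \<in> V \<Longrightarrow> \<sigma> v \<in> carrier (poly_ring W)"
  shows "subst \<sigma> \<in> Ring.ring_hom (poly_ring V) (poly_ring W)"
  by (rule ring_hom_memI) (simp_all add: poly_ring_sel subst_add subst_mult subst_closed[OF _ assms])

section \<open>Remainders modulo a monic polynomial\<close>

text \<open>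
  \<open>power_rem \<mu> d m a\<close> is the coefficient of \<open>x\<^sup>a\<close> in the remainder of \<open>x\<^sup>m\<close> modulo the monic polynomial
  \<open>x\<^sup>\<mu> - (d 0 + d 1 x + \<dots> + d (\<mu> - 1) x\<^bsup>\<mu> - 1\<^esup>)\<close>, meaningful for \<open>a < \<mu>\<close>.
\<close>

primrec power_rem :: "nat \<Rightarrow> (nat \<Rightarrow> 'a::comm_ring_1) \<Rightarrow> nat \<Rightarrow> nat \<Rightarrow> 'a" where
  "power_rem \<mu> d 0 a = (if a = 0 then 1 else 0)"
| "power_rem \<mu> d (Suc m) a = (if a = 0 then 0 else power_rem \<mu> d m (a - 1)) + d a * power_rem \<mu> d m (\<mu> - 1)"

text \<open>
  The coefficient of \<open>x\<^sup>a\<close> in the remainder of \<open>v(x) x\<^sup>s\<close>, where \<open>v(x)\<close> has the coefficients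
  \<open>v 0, \<dots>, v (\<mu> - 1)\<close>.  As a matrix with row \<open>a\<close> and column \<open>s\<close> it describes multiplication by \<open>v(x)\<close>.
\<close>

definition shifted_rem :: "nat \<Rightarrow> (nat \<Rightarrow> 'a::comm_ring_1) \<Rightarrow> (nat \<Rightarrow> 'a) \<Rightarrow> nat \<Rightarrow> nat \<Rightarrow> 'a" where
  "shifted_rem \<mu> d v s a = (\<Sum>l<\<mu>. v l * power_rem \<mu> d (l + s) a)"

lemma power_rem_less: "m < \<mu> \<Longrightarrow> a < \<mu> \<Longrightarrow> power_rem \<mu> d m a = (if a = m then 1 else 0)"
  by (induction m arbitrary: a) auto

lemma power_rem_top: "a < \<mu> \<Longrightarrow> power_rem \<mu> d \<mu> a = d a"
  by (cases \<mu>) (auto simp: power_rem_less)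

lemma shifted_rem_0: "a < \<mu> \<Longrightarrow> shifted_rem \<mu> d v 0 a = v a"
  by (simp add: shifted_rem_def power_rem_less if_distrib[of "(*) _"] sum.delta cong: if_cong)

lemma shifted_rem_Suc:
  "shifted_rem \<mu> d v (Suc s) a
    = (if a = 0 then 0 else shifted_rem \<mu> d v s (a - 1)) + d a * shifted_rem \<mu> d v s (\<mu> - 1)"
  by (simp add: shifted_rem_def sum_distrib_left sum.distrib algebra_simps)

text \<open>
  Reducing \<open>x\<^sup>m\<close> before multiplying by \<open>x\<^sup>s\<close> does not change the remainder: both sides obey the same
  recursion in \<open>s\<close>.
\<close>

lemma shifted_power_rem:
  "a < \<mu> \<Longrightarrow> shifted_rem \<mu> d (power_rem \<mu> d m) s a = power_rem \<mu> d (m + s) a"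
proof (induction s arbitrary: a)
  case 0
  thus ?case by (simp add: shifted_rem_0)
next
  case (Suc s)
  thus ?case by (simp add: shifted_rem_Suc)
qed

text \<open>
  The composite of the multiplications by \<open>v(x)\<close> and \<open>w(x)\<close>, applied to \<open>x\<^sup>s\<close>, is the remainder of
  \<open>v(x) w(x) x\<^sup>s\<close>, an expression symmetric in \<open>v\<close> and \<open>w\<close>.  This is what makes the matrices commute.
\<close>

lemma shifted_rem_comp:
  assumes "a < \<mu>"
  shows "(\<Sum>r<\<mu>. shifted_rem \<mu> d v r a * shifted_rem \<mu> d w s r)
       = (\<Sum>l<\<mu>. \<Sum>j<\<mu>. v l * w j * power_rem \<mu> d (l + j + s) a)"
proof -
  have *: "shifted_rem \<mu> d (power_rem \<mu> d (j + s)) l a = power_rem \<mu> d (l + j + s) a" for j l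
    using shifted_power_rem[OF assms, of d "j + s" l] by (simp add: add_ac)
  have "(\<Sum>r<\<mu>. shifted_rem \<mu> d v r a * shifted_rem \<mu> d w s r)
      = (\<Sum>r<\<mu>. \<Sum>l<\<mu>. \<Sum>j<\<mu>. v l * w j * (power_rem \<mu> d (j + s) r * power_rem \<mu> d (r + l) a))"
    by (simp add: shifted_rem_def sum_product algebra_simps)
  also have "\<dots> = (\<Sum>l<\<mu>. \<Sum>j<\<mu>. \<Sum>r<\<mu>. v l * w j * (power_rem \<mu> d (j + s) r * power_rem \<mu> d (r + l) a))"
    by (subst sum.swap) (intro sum.cong refl sum.swap)
  also have "\<dots> = (\<Sum>l<\<mu>. \<Sum>j<\<mu>. v l * w j * shifted_rem \<mu> d (power_rem \<mu> d (j + s)) l a)"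
    by (simp add: shifted_rem_def sum_distrib_left)
  finally show ?thesis by (simp only: *)
qed

lemma shifted_rem_commute:
  assumes "a < \<mu>"
  shows "(\<Sum>r<\<mu>. shifted_rem \<mu> d v r a * shifted_rem \<mu> d w s r)
       = (\<Sum>r<\<mu>. shifted_rem \<mu> d w r a * shifted_rem \<mu> d v s r)"
  unfolding shifted_rem_comp[OF assms] by (subst sum.swap) (simp add: mult_ac add_ac)

lemma power_rem_in_poly_ring:
  assumes "\<And>a. a < \<mu> \<Longrightarrow> d a \<in> carrier (poly_ring V)" and "a < \<mu>"
  shows "power_rem \<mu> d m a \<in> carrier (poly_ring V)"
  using assms(2)
proof (induction m arbitrary: a)
  case 0
  thus ?case by (simp add: poly_ring_closed)
next
  case (Suc m)
  have "power_rem \<mu> d m (a - 1) \<in> carrier (poly_ring V)" "power_rem \<mu> d m (\<mu> - 1) \<in> carrier (poly_ring V)"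
    using Suc.prems by (auto intro!: Suc.IH)
  thus ?case using assms(1)[OF Suc.prems] by (simp add: poly_ring_closed)
qed

lemma shifted_rem_in_poly_ring:
  assumes "\<And>a. a < \<mu> \<Longrightarrow> d a \<in> carrier (poly_ring V)" "\<And>a. a < \<mu> \<Longrightarrow> v a \<in> carrier (poly_ring V)"
    and "a < \<mu>"
  shows "shifted_rem \<mu> d v s a \<in> carrier (poly_ring V)"
  unfolding shifted_rem_def
  using assms by (intro sum_in_poly_ring poly_ring_closed(2) power_rem_in_poly_ring) auto

section \<open>The border of a set of powers of one indeterminate\<close>

definition position :: "'x list \<Rightarrow> 'x \<Rightarrow> nat" where
  "position xs x = (THE m. m < length xs \<and> xs ! m = x)"

lemma position_nth: "distinct xs \<Longrightarrow> m < length xs \<Longrightarrow> position xs (xs ! m) = m"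
  unfolding position_def by (rule the_equality) (auto simp: nth_eq_iff_index_eq)

lemma position_less: "distinct xs \<Longrightarrow> x \<in> set xs \<Longrightarrow> position xs x < length xs"
  and nth_position: "distinct xs \<Longrightarrow> x \<in> set xs \<Longrightarrow> xs ! position xs x = x"
  by (auto simp: in_set_conv_nth position_nth)

locale power_border_basis =
  fixes n \<mu> :: nat and ts bs :: "pterm list"
  assumes n: "n \<ge> 1" and \<mu>: "\<mu> \<ge> 1"
    and ts: "distinct ts" "set ts = {Poly_Mapping.single n i | i. i < \<mu>}"
    and bs: "distinct bs" "set bs = border n (set ts)"
begin

text \<open>
  The exponent vectors of indeterminates and the bounds \<open>1 \<le> k\<close> contain the literal \<open>1\<close>; keeping it
  intact lets the rules stated with it apply.
\<close>

declare One_nat_def [simp del]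

text \<open>
  The enumeration of the terms is arbitrary; \<open>expo\<close> and \<open>row_of\<close> translate between positions and
  exponents of \<open>x\<^sub>n\<close>.
\<close>

definition expo :: "nat \<Rightarrow> nat" where "expo i = Poly_Mapping.lookup (ts ! i) n"

definition row_of :: "nat \<Rightarrow> nat" where "row_of a = position ts (Poly_Mapping.single n a)"

text \<open>
  The border term \<open>x\<^sub>n\<^sup>\<mu>\<close> is addressed as \<open>x\<^sub>n \<cdot> x\<^sub>n\<^bsup>\<mu> - 1\<^esup>\<close>, hence by \<open>col_of n (\<mu> - 1)\<close>.
\<close>

definition col_of :: "nat \<Rightarrow> nat \<Rightarrow> nat" where
  "col_of k j = position bs (times_var k (Poly_Mapping.single n j))"

lemma nth_ts:
  assumes "i < length ts"
  shows "ts ! i = Poly_Mapping.single n (expo i)" and "expo i < \<mu>"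
proof -
  have "ts ! i \<in> set ts" using assms by simp
  thus "ts ! i = Poly_Mapping.single n (expo i)" "expo i < \<mu>"
    unfolding ts(2) by (auto simp: expo_def)
qed

lemma row_of_less: "a < \<mu> \<Longrightarrow> row_of a < length ts"
  unfolding row_of_def using position_less[OF ts(1)] ts(2) by blast

lemma expo_row_of: "a < \<mu> \<Longrightarrow> expo (row_of a) = a"
proof -
  assume "a < \<mu>"
  hence "Poly_Mapping.single n a \<in> set ts" unfolding ts(2) by blast
  thus ?thesis unfolding row_of_def expo_def by (simp add: nth_position[OF ts(1)])
qed

lemma row_of_expo: "i < length ts \<Longrightarrow> row_of (expo i) = i"
  unfolding row_of_def using position_nth[OF ts(1)] nth_ts(1) by metis

lemma sum_expo: "(\<Sum>r\<in>{0..<length ts}. F (expo r)) = (\<Sum>a<\<mu>. F a)"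
  by (rule sum.reindex_bij_witness[where i = row_of and j = expo])
    (simp_all add: row_of_expo expo_row_of row_of_less nth_ts(2))

lemma times_var_in_ts: "times_var k (Poly_Mapping.single n j) \<in> set ts \<longleftrightarrow> k = n \<and> Suc j < \<mu>"
proof
  assume "times_var k (Poly_Mapping.single n j) \<in> set ts"
  then obtain i where i: "i < \<mu>" "Poly_Mapping.single k 1 + Poly_Mapping.single n j = Poly_Mapping.single n i"
    by (auto simp: ts(2) times_var_def)
  from arg_cong[OF i(2), of "\<lambda>t. Poly_Mapping.lookup t k"] have "k = n"
    by (auto simp: lookup_add lookup_single when_def split: if_splits)
  moreover from arg_cong[OF i(2), of "\<lambda>t. Poly_Mapping.lookup t n"] this i(1) have "Suc j < \<mu>"
    by (simp add: lookup_add lookup_single)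
  ultimately show "k = n \<and> Suc j < \<mu>" ..
next
  assume "k = n \<and> Suc j < \<mu>"
  thus "times_var k (Poly_Mapping.single n j) \<in> set ts"
    by (auto simp: ts(2) times_var_def simp flip: single_add)
qed

text \<open>
  Multiplication by \<open>x\<^sub>n\<close> leaves the order ideal only at the highest power, while multiplication by any
  other indeterminate always leaves it.
\<close>

lemma in_bs_iff:
  "t \<in> set bs \<longleftrightarrow> (\<exists>k j. t = times_var k (Poly_Mapping.single n j) \<and>
      (1 \<le> k \<and> k < n \<and> j < \<mu> \<or> k = n \<and> j = \<mu> - 1))"
proof
  assume "t \<in> set bs"
  then obtain k j where k: "1 \<le> k" "k \<le> n" "j < \<mu>" "t = times_var k (Poly_Mapping.single n j)" "t \<notin> set ts"
    unfolding bs(2) border_def by (auto simp: ts(2))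
  hence "k \<noteq> n \<or> \<not> Suc j < \<mu>" using times_var_in_ts by blast
  with k have "1 \<le> k \<and> k < n \<and> j < \<mu> \<or> k = n \<and> j = \<mu> - 1" by linarith
  with k(4) show "\<exists>k j. t = times_var k (Poly_Mapping.single n j) \<and>
      (1 \<le> k \<and> k < n \<and> j < \<mu> \<or> k = n \<and> j = \<mu> - 1)" by blast
next
  assume "\<exists>k j. t = times_var k (Poly_Mapping.single n j) \<and>
      (1 \<le> k \<and> k < n \<and> j < \<mu> \<or> k = n \<and> j = \<mu> - 1)"
  then obtain k j where t: "t = times_var k (Poly_Mapping.single n j)"
    and kj: "1 \<le> k \<and> k < n \<and> j < \<mu> \<or> k = n \<and> j = \<mu> - 1" by blast
  have "t \<notin> set ts" unfolding t times_var_in_ts using kj by auto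
  moreover have "k \<in> {1..n}" "j < \<mu>" using kj n \<mu> by auto
  hence "t \<in> (\<Union>k \<in> {1..n}. times_var k ` set ts)" unfolding t ts(2) by blast
  ultimately show "t \<in> set bs" unfolding bs(2) border_def by blast
qed

lemma col_of:
  assumes "1 \<le> k \<and> k < n \<and> j < \<mu> \<or> k = n \<and> j = \<mu> - 1"
  shows "col_of k j < length bs" and "bs ! col_of k j = times_var k (Poly_Mapping.single n j)"
  unfolding col_of_def
  using position_less[OF bs(1)] nth_position[OF bs(1)] in_bs_iff assms by blast+

lemma col_cases:
  assumes "m < length bs"
  obtains k j where "1 \<le> k" "k < n" "j < \<mu>" "m = col_of k j" | "m = col_of n (\<mu> - 1)"
proof -
  have "bs ! m \<in> set bs" using assms by simp
  then obtain k j where t: "bs ! m = times_var k (Poly_Mapping.single n j)"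
    and kj: "1 \<le> k \<and> k < n \<and> j < \<mu> \<or> k = n \<and> j = \<mu> - 1"
    unfolding in_bs_iff by blast
  have "m = col_of k j" unfolding col_of_def t[symmetric] by (simp add: position_nth[OF bs(1) assms])
  with kj that show thesis by blast
qed

abbreviation A :: "nat \<Rightarrow> (nat \<times> nat, 'k::field) mpoly mat" where
  "A k \<equiv> generic_mult_mat ts bs k"

lemma generic_mult_mat_entry:
  assumes "i < length ts" "j < length ts"
  shows "A k $$ (i, j) =
    (if k = n \<and> Suc (expo j) < \<mu> then if expo i = Suc (expo j) then 1 else 0 else Var (i, col_of k (expo j)))"
proof -
  have "times_var n (Poly_Mapping.single n (expo j)) = Poly_Mapping.single n (Suc (expo j))"
    by (simp add: times_var_def Suc_eq_plus1_left flip: single_add)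
  hence "ts ! i = times_var n (Poly_Mapping.single n (expo j)) \<longleftrightarrow> expo i = Suc (expo j)"
    using nth_ts(1)[OF assms(1)] by (metis lookup_single_eq)
  thus ?thesis
    using assms nth_ts(1)[OF assms(2)]
    by (auto simp: generic_mult_mat_def Let_def times_var_in_ts col_of_def position_def)
qed

section \<open>Parametrization of the generic multiplication matrices\<close>

text \<open>
  The parameters are indexed by \<open>1 \<le> k \<le> n\<close> and \<open>a < \<mu>\<close> and numbered blockwise from \<open>1\<close>.  For \<open>k < n\<close>,
  \<open>par k\<close> stands for the column of \<open>A k\<close> at the term \<open>1\<close>, and \<open>par n\<close> for the remainder of \<open>x\<^sub>n\<^sup>\<mu>\<close>.
\<close>

definition par :: "nat \<Rightarrow> nat \<Rightarrow> (nat, 'k::field) mpoly" where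
  "par k a = Var ((k - 1) * \<mu> + a + 1)"

lemma par_in_poly_ring:
  assumes "1 \<le> k" "k \<le> n" "a < \<mu>"
  shows "par k a \<in> carrier (poly_ring {1..\<mu> * n})"
proof -
  have "(k - 1) * \<mu> + a + 1 \<le> (k - 1) * \<mu> + \<mu>" using assms by simp
  also have "\<dots> = k * \<mu>" using assms(1) by (simp add: algebra_simps)
  also have "\<dots> \<le> n * \<mu>" using assms(2) by simp
  finally show ?thesis unfolding par_def by (intro Var_in_poly_ring) (simp add: mult.commute)
qed

text \<open>
  The values forced by the relations: \<open>x\<^sub>k x\<^sub>n\<^sup>j\<close> goes to the column of coefficients of the remainder of
  \<open>(\<Sum>l<\<mu>. par k l x\<^sub>n\<^sup>l) x\<^sub>n\<^sup>j\<close>.  For such a term with \<open>k < n\<close>, the index \<open>k\<close> is recovered as the only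
  indeterminate other than \<open>x\<^sub>n\<close> that occurs in it, and \<open>j\<close> as the exponent of \<open>x\<^sub>n\<close>.
\<close>

definition \<phi> :: "nat \<times> nat \<Rightarrow> (nat, 'k::field) mpoly" where
  "\<phi> = (\<lambda>(i, m). let t = bs ! m in
     if t = Poly_Mapping.single n \<mu> then par n (expo i)
     else shifted_rem \<mu> (par n) (par (the_elem (Poly_Mapping.keys t - {n}))) (Poly_Mapping.lookup t n) (expo i))"

lemma \<phi>_top: "\<phi> (i, col_of n (\<mu> - 1)) = par n (expo i)"
proof -
  have "bs ! col_of n (\<mu> - 1) = Poly_Mapping.single n \<mu>"
    using col_of(2)[of n "\<mu> - 1"] \<mu> by (simp add: times_var_def flip: single_add)
  thus ?thesis by (simp add: \<phi>_def)
qed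

lemma \<phi>_col:
  assumes "1 \<le> k" "k < n" "j < \<mu>"
  shows "\<phi> (i, col_of k j) = shifted_rem \<mu> (par n) (par k) j (expo i)"
proof -
  let ?t = "Poly_Mapping.single k 1 + Poly_Mapping.single n j"
  have t: "bs ! col_of k j = ?t" using col_of(2)[of k j] assms by (simp add: times_var_def)
  have l: "Poly_Mapping.lookup ?t x = (if x = k then 1 else if x = n then j else 0)" for x
    using assms by (simp add: lookup_add lookup_single when_def)
  have "Poly_Mapping.keys ?t - {n} = {k}" using assms by (auto simp: in_keys_iff l split: if_splits)
  moreover have "?t \<noteq> Poly_Mapping.single n \<mu>"
  proof
    assume "?t = Poly_Mapping.single n \<mu>"
    from arg_cong[OF this, of "\<lambda>t. Poly_Mapping.lookup t k"] show False
      using assms by (simp add: l lookup_single)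
  qed
  moreover have "Poly_Mapping.lookup ?t n = j" using assms by (simp only: l) simp
  ultimately show ?thesis by (simp add: \<phi>_def t)
qed

text \<open>
  The image of \<open>A k\<close> under \<open>\<phi>\<close> is multiplication by the polynomial with these coefficients; for \<open>k = n\<close>
  this is the remainder of \<open>x\<^sub>n\<close>, which differs from \<open>x\<^sub>n\<close> itself when \<open>\<mu> = 1\<close>.
\<close>

definition first_col :: "nat \<Rightarrow> nat \<Rightarrow> (nat, 'k::field) mpoly" where
  "first_col k = (if k = n then power_rem \<mu> (par n) 1 else par k)"

lemma subst_generic_mult_mat:
  assumes "1 \<le> k" "k \<le> n" "i < length ts" "j < length ts"
  shows "subst \<phi> (A k $$ (i, j)) = shifted_rem \<mu> (par n) (first_col k) (expo j) (expo i)"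
proof (cases "k = n")
  case False
  thus ?thesis
    using assms nth_ts(2)[OF assms(4)]
    by (simp add: generic_mult_mat_entry subst_Var \<phi>_col first_col_def)
next
  case True
  have ij: "expo i < \<mu>" "expo j < \<mu>" using assms nth_ts(2) by auto
  have "shifted_rem \<mu> (par n) (first_col k) (expo j) (expo i) = power_rem \<mu> (par n) (Suc (expo j)) (expo i)"
    using True shifted_power_rem[OF ij(1), of "par n" 1 "expo j"] 
    by (simp add: first_col_def Suc_eq_plus1_left del: power_rem.simps)
  also have "\<dots> = subst \<phi> (A k $$ (i, j))"
  proof (cases "Suc (expo j) < \<mu>")
    case less: True
    thus ?thesis using True assms ij by (simp add: generic_mult_mat_entry power_rem_less del: power_rem.simps)
  next
    case False
    hence "Suc (expo j) = \<mu>" using ij by simp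
    moreover from this have "expo j = \<mu> - 1" by simp
    ultimately show ?thesis
      using True assms ij by (simp add: generic_mult_mat_entry subst_Var \<phi>_top power_rem_top del: power_rem.simps)
  qed
  finally show ?thesis ..
qed

lemma mult_entry:
  assumes "i < length ts" "j < length ts"
  shows "(A k * A l) $$ (i, j) = (\<Sum>r\<in>{0..<length ts}. A k $$ (i, r) * A l $$ (r, j))"
  using assms by (simp add: generic_mult_mat_def scalar_prod_def)

lemma dim_A: "dim_row (A k) = length ts" "dim_col (A k) = length ts"
  by (simp_all add: generic_mult_mat_def)

lemma A_carrier: "A k \<in> carrier_mat (length ts) (length ts)"
  by (simp add: generic_mult_mat_def)

lemma subst_mult_entry:
  assumes "1 \<le> k" "k \<le> n" "1 \<le> l" "l \<le> n" "i < length ts" "j < length ts"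
  shows "subst \<phi> ((A k * A l) $$ (i, j))
       = (\<Sum>r<\<mu>. shifted_rem \<mu> (par n) (first_col k) r (expo i) * shifted_rem \<mu> (par n) (first_col l) (expo j) r)"
  using assms
  by (simp add: mult_entry subst_sum subst_mult subst_generic_mult_mat
      flip: sum_expo)

section \<open>The coordinate ring as a polynomial ring\<close>

definition relations :: "(nat \<times> nat, 'k::field) mpoly set" where
  "relations = \<Union>{elements_mat (A k * A l - A l * A k) | k l. 1 \<le> k \<and> k < l \<and> l \<le> n}"

lemma relationsE:
  assumes "P \<in> relations"
  obtains k l i j where "1 \<le> k" "k < l" "l \<le> n" "i < length ts" "j < length ts"
    "P = (A k * A l) $$ (i, j) - (A l * A k) $$ (i, j)"
proof -
  from assms obtain k l where kl: "1 \<le> k" "k < l" "l \<le> n" and P: "P \<in> elements_mat (A k * A l - A l * A k)"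
    unfolding relations_def by blast
  from elements_matD[OF P] obtain i j where "i < length ts" "j < length ts" "P = (A k * A l - A l * A k) $$ (i, j)"
    by (auto simp: dim_A)
  with kl that show thesis by (simp add: dim_A)
qed

text \<open>
  After the substitution both matrices are multiplications by polynomials modulo one monic polynomial.
\<close>

lemma subst_relation: "P \<in> relations \<Longrightarrow> subst \<phi> P = 0"
  by (erule relationsE) (simp add: subst_diff subst_mult_entry shifted_rem_commute[of _ \<mu> "par n"] nth_ts(2))

lemma entry_in_coord_ring:
  assumes "1 \<le> k" "k \<le> n" "i < length ts" "j < length ts"
  shows "A k $$ (i, j) \<in> carrier (coord_ring ts bs)"
proof -
  have "expo j = \<mu> - 1" if "\<not> Suc (expo j) < \<mu>" using that nth_ts(2)[OF assms(4)] by simp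
  hence "col_of k (expo j) < length bs" if "k \<noteq> n \<or> \<not> Suc (expo j) < \<mu>"
    using that assms nth_ts(2)[OF assms(4)] by (intro col_of(1)) auto
  thus ?thesis using assms
    by (auto simp: generic_mult_mat_entry coord_ring_def poly_ring_closed intro!: Var_in_poly_ring)
qed

lemma relations_subset: "relations \<subseteq> carrier (coord_ring ts bs)"
proof
  fix P assume "P \<in> (relations :: (nat \<times> nat, 'k::field) mpoly set)"
  then show "P \<in> carrier (coord_ring ts bs)"
  proof (rule relationsE)
    fix k l i j
    assume *: "1 \<le> k" "k < l" "l \<le> n" "i < length ts" "j < length ts"
      "P = (A k * A l) $$ (i, j) - (A l * A k) $$ (i, j)"
    have "(A k :: (nat \<times> nat, 'k) mpoly mat) $$ (i', j') \<in> carrier (coord_ring ts bs)"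
         "(A l :: (nat \<times> nat, 'k) mpoly mat) $$ (i', j') \<in> carrier (coord_ring ts bs)"
      if "i' < length ts" "j' < length ts" for i' j'
      using * that by (auto intro!: entry_in_coord_ring)
    thus ?thesis unfolding *(6) mult_entry[OF *(4,5)] coord_ring_def
      using * by (intro poly_ring_closed sum_in_poly_ring) auto
  qed
qed

abbreviation I :: "(nat \<times> nat, 'k::field) mpoly set" where
  "I \<equiv> border_basis_ideal n ts bs"

lemma I_eq: "I = genideal (coord_ring ts bs) relations"
  by (simp add: border_basis_ideal_def relations_def)

lemma ideal_I: "ideal I (coord_ring ts bs)"
  and relations_I: "relations \<subseteq> I"
proof -
  interpret cring "coord_ring ts bs" unfolding coord_ring_def by (rule cring_poly_ring)
  show "ideal I (coord_ring ts bs)" unfolding I_eq by (rule genideal_ideal[OF relations_subset])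
  show "relations \<subseteq> I" unfolding I_eq by (rule genideal_self[OF relations_subset])
qed

lemma I_add: "P \<in> I \<Longrightarrow> Q \<in> I \<Longrightarrow> P + Q \<in> I"
  and I_mult: "P \<in> carrier (coord_ring ts bs) \<Longrightarrow> Q \<in> I \<Longrightarrow> P * Q \<in> I"
  and I_subset: "I \<subseteq> carrier (coord_ring ts bs)"
  and I_0: "0 \<in> I"
proof -
  interpret ideal I "coord_ring ts bs" by (rule ideal_I)
  show "P \<in> I \<Longrightarrow> Q \<in> I \<Longrightarrow> P + Q \<in> I"
    using additive_subgroup.a_closed[OF additive_subgroup_axioms, of P Q]
    by (simp add: coord_ring_def poly_ring_sel)
  show "P \<in> carrier (coord_ring ts bs) \<Longrightarrow> Q \<in> I \<Longrightarrow> P * Q \<in> I"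
    using I_l_closed[of Q P] by (simp add: coord_ring_def poly_ring_sel)
  show "I \<subseteq> carrier (coord_ring ts bs)" by (rule a_subset)
  show "0 \<in> I" 
    using additive_subgroup.zero_closed[OF additive_subgroup_axioms] by (simp add: coord_ring_def poly_ring_sel)
qed

lemma I_uminus:
  assumes "P \<in> I"
  shows "- P \<in> I"
proof -
  have "0 - 1 \<in> carrier (coord_ring ts bs)"
    unfolding coord_ring_def by (intro poly_ring_closed)
  from I_mult[OF this assms] show ?thesis by simp
qed

text \<open>
  The inverse of the numbering in \<open>par\<close>, followed by reading the parameter \<open>par k a\<close> as the coefficient at
  \<open>x\<^sub>n\<^sup>a\<close> of the border term \<open>x\<^sub>k\<close>, or of \<open>x\<^sub>n\<^sup>\<mu>\<close> if \<open>k = n\<close>.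
\<close>

definition \<psi> :: "nat \<Rightarrow> (nat \<times> nat, 'k::field) mpoly" where
  "\<psi> q = (let k = (q - 1) div \<mu> + 1; a = (q - 1) mod \<mu>
     in Var (row_of a, if k = n then col_of n (\<mu> - 1) else col_of k 0))"

lemma \<psi>_closed:
  assumes "q \<in> {1..\<mu> * n}"
  shows "\<psi> q \<in> carrier (coord_ring ts bs)"
proof -
  have "(q - 1) div \<mu> < n" using assms \<mu> by (intro div_less_iff_less_mult[THEN iffD2]) (auto simp: mult.commute)
  hence "(if (q - 1) div \<mu> + 1 = n then col_of n (\<mu> - 1) else col_of ((q - 1) div \<mu> + 1) 0) < length bs"
    using col_of(1) \<mu> by auto
  moreover have "row_of ((q - 1) mod \<mu>) < length ts" using \<mu> by (intro row_of_less) simp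
  ultimately show ?thesis
    unfolding \<psi>_def Let_def coord_ring_def by (intro Var_in_poly_ring) simp
qed

lemma subst_par:
  assumes "1 \<le> k" "a < \<mu>"
  shows "subst \<psi> (par k a) = Var (row_of a, if k = n then col_of n (\<mu> - 1) else col_of k 0)"
  using assms by (simp add: par_def subst_Var \<psi>_def Let_def)

lemma \<phi>_closed:
  assumes "v \<in> {..<length ts} \<times> {..<length bs}"
  shows "\<phi> v \<in> carrier (poly_ring {1..\<mu> * n})"
proof -
  obtain i m where v: "v = (i, m)" "i < length ts" "m < length bs" using assms by auto
  from v(3) show ?thesis
  proof (cases rule: col_cases)
    case (1 k j)
    thus ?thesis using v n nth_ts(2)[OF v(2)]
      by (auto simp: \<phi>_col intro!: shifted_rem_in_poly_ring par_in_poly_ring)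
  next
    case 2
    thus ?thesis using v n nth_ts(2)[OF v(2)] by (auto simp: \<phi>_top intro!: par_in_poly_ring)
  qed
qed

text \<open>
  The entry of \<open>A n * A k - A k * A n\<close> in the row of \<open>x\<^sub>n\<^sup>a\<close> and the column of \<open>x\<^sub>n\<^sup>j\<close>.  It says that modulo
  the ideal, the column of \<open>x\<^sub>k x\<^sub>n\<^bsup>j + 1\<^esup>\<close> arises from that of \<open>x\<^sub>k x\<^sub>n\<^sup>j\<close> by the recursion for remainders.
\<close>

lemma col_relation:
  assumes "1 \<le> k" "k < n" "Suc j < \<mu>" "a < \<mu>"
  shows "(if a = 0 then 0 else Var (row_of (a - 1), col_of k j))
       + Var (row_of a, col_of n (\<mu> - 1)) * Var (row_of (\<mu> - 1), col_of k j)
       - Var (row_of a, col_of k (Suc j)) \<in> (I :: (nat \<times> nat, 'k::field) mpoly set)"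
proof -
  let ?i = "row_of a" and ?j = "row_of j"
  let ?V = "\<lambda>c. Var (row_of c, col_of k j) :: (nat \<times> nat, 'k) mpoly"
  let ?T = "Var (?i, col_of n (\<mu> - 1)) :: (nat \<times> nat, 'k) mpoly"
  have j: "j < \<mu>" using assms by simp
  have lt: "?i < length ts" "?j < length ts" using assms j by (simp_all add: row_of_less)
  have "(A k * A n) $$ (?i, ?j)
      = (\<Sum>r\<in>{0..<length ts}. Var (?i, col_of k (expo r)) * (if expo r = Suc j then 1 else 0 :: (nat \<times> nat, 'k) mpoly))"
    unfolding mult_entry[OF lt]
    by (intro sum.cong refl) (use assms lt j in \<open>simp add: generic_mult_mat_entry expo_row_of\<close>)
  also have "\<dots> = (\<Sum>c<\<mu>. Var (?i, col_of k c) * (if c = Suc j then 1 else 0))"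
    by (rule sum_expo)
  also have "\<dots> = Var (?i, col_of k (Suc j))"
    using assms by (simp add: if_distrib[of "(*) _"] sum.delta cong: if_cong)
  \<comment> \<open>\<open>A n\<close> has a single nonzero entry, a \<open>1\<close>, in the column of \<open>x\<^sub>n\<^sup>j\<close>, because \<open>x\<^sub>n\<^bsup>j + 1\<^esup>\<close> lies in the order ideal.\<close>
  finally have 1: "(A k * A n) $$ (?i, ?j) = (Var (?i, col_of k (Suc j)) :: (nat \<times> nat, 'k) mpoly)" .
  have "(A n * A k) $$ (?i, ?j)
      = (\<Sum>r\<in>{0..<length ts}. (if Suc (expo r) < \<mu> then if a = Suc (expo r) then 1 else 0 else ?T) * ?V (expo r))"
    unfolding mult_entry[OF lt]
  proof (intro sum.cong refl)
    fix r assume "r \<in> {0..<length ts}"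
    hence r: "r < length ts" by simp
    have "expo r = \<mu> - 1" if "\<not> Suc (expo r) < \<mu>" using that nth_ts(2)[OF r] by simp
    thus "A n $$ (?i, r) * A k $$ (r, ?j)
        = (if Suc (expo r) < \<mu> then if a = Suc (expo r) then 1 else 0 else ?T) * ?V (expo r)"
      using assms lt j r by (simp add: generic_mult_mat_entry expo_row_of row_of_expo)
  qed
  also have "\<dots> = (\<Sum>c<\<mu>. (if Suc c < \<mu> then if a = Suc c then 1 else 0 else ?T) * ?V c)"
    by (rule sum_expo)
  \<comment> \<open>In row \<open>a\<close> of \<open>A n\<close>, the last exponent carries an indeterminate, and \<open>a - 1\<close> carries \<open>1\<close>.\<close>
  also have "{..<\<mu>} = insert (\<mu> - 1) {..<\<mu> - 1}" using \<mu> by auto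
  also have "(\<Sum>c\<in>\<dots>. (if Suc c < \<mu> then if a = Suc c then 1 else 0 else ?T) * ?V c)
      = ?T * ?V (\<mu> - 1) + (\<Sum>c<\<mu> - 1. if a = Suc c then ?V c else 0)"
    using \<mu> by (subst sum.insert) (auto intro!: sum.cong)
  also have "(\<Sum>c<\<mu> - 1. if a = Suc c then ?V c else 0) = (if a = 0 then 0 else ?V (a - 1))"
    using assms(4) by (cases a) (auto simp: sum.delta)
  finally have 2: "(A n * A k) $$ (?i, ?j) = ?T * ?V (\<mu> - 1) + (if a = 0 then 0 else ?V (a - 1))" .
  have "(A k * A n - A n * A k) $$ (?i, ?j) \<in> (relations :: (nat \<times> nat, 'k) mpoly set)"
  proof -
    have "(A k * A n - A n * A k) $$ (?i, ?j) \<in> elements_mat (A k * A n - A n * A k :: (nat \<times> nat, 'k) mpoly mat)"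
      by (rule elements_matI[OF minus_carrier_mat[OF mult_carrier_mat[OF A_carrier A_carrier]] lt refl])
    thus ?thesis unfolding relations_def using assms by blast
  qed
  from subsetD[OF relations_I this] have "- ((A k * A n) $$ (?i, ?j) - (A n * A k) $$ (?i, ?j)) \<in> (I :: (nat \<times> nat, 'k) mpoly set)"
    using lt by (intro I_uminus) (simp add: dim_A del: index_mult_mat(1))
  thus ?thesis unfolding 1 2 by (simp add: algebra_simps)
qed

text \<open>
  By \<open>shifted_rem_Suc\<close> and \<open>col_relation\<close>, both terms of the difference satisfy the same recursion in \<open>j\<close>
  modulo the ideal, and they agree for \<open>j = 0\<close>.
\<close>

lemma subst_\<psi>_\<phi>_col:
  assumes "1 \<le> k" "k < n" "j < \<mu>" "a < \<mu>"
  shows "subst \<psi> (shifted_rem \<mu> (par n) (par k) j a) - Var (row_of a, col_of k j)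
      \<in> (I :: (nat \<times> nat, 'k::field) mpoly set)"
  using assms(3,4)
proof (induction j arbitrary: a)
  case 0
  thus ?case using assms by (simp add: shifted_rem_0 subst_par I_0)
next
  case (Suc j)
  let ?s = "\<lambda>a. subst \<psi> (shifted_rem \<mu> (par n) (par k) j a) :: (nat \<times> nat, 'k) mpoly"
  let ?V = "\<lambda>c. Var (row_of c, col_of k j) :: (nat \<times> nat, 'k) mpoly"
  let ?T = "Var (row_of a, col_of n (\<mu> - 1)) :: (nat \<times> nat, 'k) mpoly"
  have T: "?T \<in> carrier (coord_ring ts bs)"
    using Suc.prems col_of(1)[of n "\<mu> - 1"] unfolding coord_ring_def
    by (intro Var_in_poly_ring) (simp add: row_of_less)
  have "subst \<psi> (shifted_rem \<mu> (par n) (par k) (Suc j) a)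
      = (if a = 0 then 0 else ?s (a - 1)) + ?T * ?s (\<mu> - 1)"
    using n Suc.prems by (simp add: shifted_rem_Suc subst_add subst_mult subst_par)
  moreover have "((if a = 0 then 0 else ?s (a - 1)) - (if a = 0 then 0 else ?V (a - 1)))
      + ?T * (?s (\<mu> - 1) - ?V (\<mu> - 1))
      + ((if a = 0 then 0 else ?V (a - 1)) + ?T * ?V (\<mu> - 1) - Var (row_of a, col_of k (Suc j))) \<in> I"
  proof (intro I_add I_mult T)
    show "(if a = 0 then 0 else ?s (a - 1)) - (if a = 0 then 0 else ?V (a - 1)) \<in> I"
      using Suc.IH[of "a - 1"] Suc.prems by (simp add: I_0)
    show "?s (\<mu> - 1) - ?V (\<mu> - 1) \<in> I"
      using Suc.IH[of "\<mu> - 1"] Suc.prems by simp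
  qed (rule col_relation[OF assms(1,2) Suc.prems])
  ultimately show ?case by (simp add: algebra_simps split del: if_split)
qed

text \<open>
  The polynomials for which this congruence holds form a subring containing the constants, so only
  indeterminates matter; those of the border term \<open>x\<^sub>n\<^sup>\<mu>\<close> are fixed, the others are covered by
  \<open>subst_\<psi>_\<phi>_col\<close>.
\<close>

lemma subst_\<psi>_\<phi>:
  assumes "P \<in> carrier (coord_ring ts bs)"
  shows "subst \<psi> (subst \<phi> P) - P \<in> (I :: (nat \<times> nat, 'k::field) mpoly set)"
  using assms unfolding coord_ring_def
proof (induction P rule: poly_ring_induct)
  case (Const a)
  thus ?case by (simp add: subst_Const I_0)
next
  case (Var v)
  obtain i m where v: "v = (i, m)" "i < length ts" "m < length bs" using Var by auto
  from v(3) show ?case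
  proof (cases rule: col_cases)
    case (1 k j)
    thus ?thesis using subst_\<psi>_\<phi>_col[of k j "expo i"] v nth_ts(2)[OF v(2)]
      by (simp add: subst_Var \<phi>_col row_of_expo)
  next
    case 2
    thus ?thesis using v n nth_ts(2)[OF v(2)] by (simp add: subst_Var \<phi>_top subst_par row_of_expo I_0)
  qed
next
  case (add P Q)
  show ?case using I_add[OF add.IH] by (simp add: subst_add algebra_simps)
next
  case (mult P Q)
  let ?r = "\<lambda>P. subst \<psi> (subst \<phi> P)"
  have c: "?r P \<in> carrier (coord_ring ts bs)"
    unfolding coord_ring_def using mult.hyps \<phi>_closed \<psi>_closed
    by (intro subst_closed[where V = "{1..\<mu> * n}"] subst_closed[where V = "{..<length ts} \<times> {..<length bs}"])
      (auto simp: coord_ring_def)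
  have "?r P * (?r Q - Q) + Q * (?r P - P) \<in> I"
    using mult c by (intro I_add I_mult) (auto simp: coord_ring_def)
  thus ?case by (simp add: subst_mult algebra_simps)
qed

lemma subst_\<phi>_\<psi>:
  assumes "P \<in> carrier (poly_ring {1..\<mu> * n})"
  shows "subst \<phi> (subst \<psi> P) = (P :: (nat, 'k::field) mpoly)"
  using assms
proof (induction P rule: poly_ring_induct)
  case (Var q)
  define k a where ka: "k = (q - 1) div \<mu> + 1" "a = (q - 1) mod \<mu>"
  have q: "q = (k - 1) * \<mu> + a + 1" using Var by (simp add: ka)
  have "(q - 1) div \<mu> < n" using Var \<mu> by (intro div_less_iff_less_mult[THEN iffD2]) (auto simp: mult.commute)
  hence "1 \<le> k" "k \<le> n" "a < \<mu>" using \<mu> by (auto simp: ka)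
  hence "subst \<phi> (subst \<psi> (par k a)) = (par k a :: (nat, 'k) mpoly)"
    by (auto simp: subst_par subst_Var \<phi>_top \<phi>_col expo_row_of shifted_rem_0)
  thus ?case by (simp add: par_def flip: q)
qed (simp_all add: subst_Const subst_add subst_mult)

lemma ring_hom_\<phi>: "ring_hom_ring (coord_ring ts bs) (poly_ring {1..\<mu> * n}) (subst \<phi>)"
proof (rule ring_hom_ringI2)
  show "Ring.ring (coord_ring ts bs)" "Ring.ring (poly_ring {1..\<mu> * n})"
    unfolding coord_ring_def using cring_poly_ring cring.axioms(1) by blast+
  show "subst \<phi> \<in> Ring.ring_hom (coord_ring ts bs) (poly_ring {1..\<mu> * n})"
    unfolding coord_ring_def by (rule subst_ring_hom[OF \<phi>_closed])
qed

text \<open>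
  If \<open>\<phi>\<close> kills \<open>P\<close>, then \<open>P\<close> is congruent to \<open>\<psi> (\<phi> P) = 0\<close> modulo the ideal.
\<close>

lemma kernel_\<phi>:
  "a_kernel (coord_ring ts bs) (poly_ring {1..\<mu> * n}) (subst \<phi>) = (I :: (nat \<times> nat, 'k::field) mpoly set)"
  (is "?K = _")
proof
  have mem: "P \<in> ?K \<longleftrightarrow> P \<in> carrier (coord_ring ts bs) \<and> subst \<phi> P = 0" for P
    unfolding a_kernel_def' poly_ring_sel mem_Collect_eq by (rule refl)
  interpret ring_hom_ring "coord_ring ts bs" "poly_ring {1..\<mu> * n}" "subst \<phi>" by (rule ring_hom_\<phi>)
  have "(relations :: (nat \<times> nat, 'k) mpoly set) \<subseteq> ?K"
  proof
    fix P :: "(nat \<times> nat, 'k) mpoly" assume "P \<in> relations"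
    hence "P \<in> carrier (coord_ring ts bs)" "subst \<phi> P = 0"
      by (rule subsetD[OF relations_subset], rule subst_relation)
    thus "P \<in> ?K" unfolding mem ..
  qed
  thus "I \<subseteq> ?K" unfolding I_eq by (rule R.genideal_minimal[OF kernel_is_ideal])
  show "?K \<subseteq> I"
  proof
    fix P assume "P \<in> ?K"
    hence "P \<in> carrier (coord_ring ts bs)" "subst \<phi> P = 0" unfolding mem by (rule conjunct1, rule conjunct2)
    hence "- P \<in> I" using subst_\<psi>_\<phi>[of P] by simp
    from I_uminus[OF this] show "P \<in> I" by simp
  qed
qed

lemma surj_\<phi>:
  "subst \<phi> ` carrier (coord_ring ts bs) = (carrier (poly_ring {1..\<mu> * n}) :: (nat, 'k::field) mpoly set)"
proof
  show "subst \<phi> ` carrier (coord_ring ts bs) \<subseteq> (carrier (poly_ring {1..\<mu> * n}) :: (nat, 'k) mpoly set)"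
    unfolding coord_ring_def by (intro image_subsetI subst_closed[OF _ \<phi>_closed])
  show "(carrier (poly_ring {1..\<mu> * n}) :: (nat, 'k) mpoly set) \<subseteq> subst \<phi> ` carrier (coord_ring ts bs)"
  proof
    fix P :: "(nat, 'k) mpoly" assume P: "P \<in> carrier (poly_ring {1..\<mu> * n})"
    show "P \<in> subst \<phi> ` carrier (coord_ring ts bs)"
    proof (rule image_eqI)
      show "P = subst \<phi> (subst \<psi> P)" by (rule subst_\<phi>_\<psi>[OF P, symmetric])
      show "subst \<psi> P \<in> carrier (coord_ring ts bs)"
        unfolding coord_ring_def by (rule subst_closed[OF P \<psi>_closed[unfolded coord_ring_def]])
    qed
  qed
qed

lemma border_basis_scheme_affine:
  "(border_basis_scheme n ts bs :: ('k::field, (nat \<times> nat, 'k) mpoly set) affine_scheme)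
     \<cong>\<^sub>K affine_space (\<mu> * n)"
proof -
  let ?C = "coord_ring ts bs :: (nat \<times> nat, 'k) mpoly ring"
  let ?S = "poly_ring {1..\<mu> * n} :: (nat, 'k) mpoly ring"
  let ?I = "I :: (nat \<times> nat, 'k) mpoly set"
  let ?R = "?C Quot ?I"
  define F where "F = (\<lambda>X. the_elem (subst \<phi> ` X) :: (nat, 'k) mpoly)"
  interpret ring_hom_ring ?C ?S "subst \<phi>" by (rule ring_hom_\<phi>)
  interpret I: ideal ?I ?C by (rule ideal_I)
  have C: "cring ?C" and S: "cring ?S" unfolding coord_ring_def by (rule cring_poly_ring)+
  have R: "cring ?R" by (rule I.quotient_is_cring[OF C])
  have F: "F \<in> ring_iso ?R ?S"
    using FactRing_iso_set[OF surj_\<phi>] unfolding kernel_\<phi> F_def .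
  have G: "inv_into (carrier ?R) F \<in> ring_iso ?S ?R"
    by (rule ring_iso_set_sym[OF I.quotient_is_ring F])
  have bij: "bij_betw F (carrier ?R) (carrier ?S)" using F by (simp add: ring_iso_def)
  interpret iso: inverse_ring_isos ?S ?R "inv_into (carrier ?R) F" F
  proof (intro inverse_ring_isos.intro inverse_ring_isos_axioms.intro R S)
    show "inv_into (carrier ?R) F \<in> Ring.ring_hom ?S ?R" "F \<in> Ring.ring_hom ?R ?S"
      using F G by (simp_all add: ring_iso_def)
    show "F (inv_into (carrier ?R) F y) = y" if "y \<in> carrier ?S" for y
      using bij that by (simp add: bij_betw_inv_into_right)
    show "inv_into (carrier ?R) F (F x) = x" if "x \<in> carrier ?R" for x
      using bij that by (simp add: bij_betw_inv_into_left)
  qed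
  have "inv_into (carrier ?R) F (Const a) = ?I +>\<^bsub>?C\<^esub> Const a" for a
  proof -
    have a: "Const a \<in> carrier ?C" by (simp add: coord_ring_def Const_in_poly_ring)
    have "F (?I +>\<^bsub>?C\<^esub> Const a) = Const a"
      using the_elem_simp[OF a] unfolding kernel_\<phi> F_def by (simp add: subst_Const)
    moreover have "?I +>\<^bsub>?C\<^esub> Const a \<in> carrier ?R"
      using ring_hom_closed[OF I.rcos_ring_hom a] .
    ultimately show ?thesis using iso.gh[of "?I +>\<^bsub>?C\<^esub> Const a"] by simp
  qed
  from iso.Spec_isomorphic[OF this Const_in_poly_ring] show ?thesis
    by (simp add: border_basis_scheme_def affine_space_def)
qed

end

theorem corollary3p13:
  fixes n \<mu> :: nat and ts bs :: "pterm list"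
  assumes "n \<ge> 1" and "\<mu> \<ge> 1"
    and "distinct ts" and "set ts = {Poly_Mapping.single n i | i. i < \<mu>}"
    and "distinct bs" and "set bs = border n (set ts)"
  shows "(border_basis_scheme n ts bs :: ('k::field, (nat \<times> nat, 'k) mpoly set) affine_scheme)
           \<cong>\<^sub>K affine_space (\<mu> * n)"
proof -
  interpret power_border_basis n \<mu> ts bs using assms by unfold_locales
  show ?thesis by (rule border_basis_scheme_affine)
qed

end
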